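(* Let $P$ be a right-LCM monoid and $P_1$ a submonoid such that the inclusion $P_1\subseteq P$ is closed under factorization and preserves orthogonality. For every Nica-covariant isometric representation $V:P_1\to B(\mathcal{H})$ there exist a Hilbert space $\mathcal{K}\supseteq\mathcal{H}$ and a Nica-covariant isometric representation $W:P\to B(\mathcal{K})$ such that (1) $\mathcal{H}^\perp$ is invariant under $W_p$ for all $p\in P$; (2) $P_{\mathcal{H}}W_p|_{\mathcal{H}}=V_p$ if $p\in P_1$ and $P_{\mathcal{H}}W_p|_{\mathcal{H}}=0$ if $p\notin P_1$, where $P_{\mathcal H}$ is the orthogonal projection onto $\mathcal H$; (3) $\mathcal{H}$ is reducing for $\{W_p:p\in P_1\}$, i.e. for $p\in P_1$, $W_p=\begin{bmatrix}V_p&0\\0&D_p\end{bmatrix}$ with respect to $\mathcal K=\mathcal H\oplus\mathcal H^\perp$, for some $D_p\in B(\mathcal{H}^\perp)$.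
   Context: A monoid $P$ is right-LCM if it is left-cancellative and for all $p,q\in P$ either $pP\cap qP=\emptyset$ or $pP\cap qP=rP$ for some $r\in P$; write $p\vee q=\{r: pP\cap qP=rP\}$. A submonoid $P_1\subseteq P$ is closed under factorization if $xy\in P_1$ ($x,y\in P$) implies $x,y\in P_1$ (then $P_1$ is right-LCM). The inclusion preserves orthogonality if for all $x,y\in P_1$: $xP_1\cap yP_1=\emptyset$ iff $xP\cap yP=\emptyset$. An isometric representation $V$ of a right-LCM monoid $Q$ ($V_e=I$, $V_pV_q=V_{pq}$, $V_p$ isometries) is Nica-covariant if $V_xV_x^*V_yV_y^*=V_rV_r^*$ for $r\in x\vee y$, and $=0$ if $x\vee y=\emptyset$. *)

theory Defs
  imports "HOL-Analysis.Analysis" "HOL-Library.Function_Algebras"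
begin

section \<open>Monoid notions (the monoid P is the ambient type of class monoid_mult)\<close>

definition rideal :: "'p::monoid_mult set \<Rightarrow> 'p \<Rightarrow> 'p set" where
  "rideal S x = (\<lambda>s. x * s) ` S"

definition left_cancellative :: "'p::monoid_mult set \<Rightarrow> bool" where
  "left_cancellative S \<longleftrightarrow> (\<forall>p\<in>S. \<forall>x\<in>S. \<forall>y\<in>S. p * x = p * y \<longrightarrow> x = y)"

definition right_LCM :: "'p::monoid_mult set \<Rightarrow> bool" where
  "right_LCM S \<longleftrightarrow> left_cancellative S \<and>
     (\<forall>p\<in>S. \<forall>q\<in>S. rideal S p \<inter> rideal S q = {} \<or> (\<exists>r\<in>S. rideal S p \<inter> rideal S q = rideal S r))"

definition join_in :: "'p::monoid_mult set \<Rightarrow> 'p \<Rightarrow> 'p \<Rightarrow> 'p set" where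
  "join_in S p q = {r\<in>S. rideal S p \<inter> rideal S q = rideal S r}"

definition submonoid :: "'p::monoid_mult set \<Rightarrow> bool" where
  "submonoid S \<longleftrightarrow> 1 \<in> S \<and> (\<forall>x\<in>S. \<forall>y\<in>S. x * y \<in> S)"

definition closed_under_factorization :: "'p::monoid_mult set \<Rightarrow> bool" where
  "closed_under_factorization S \<longleftrightarrow> (\<forall>x y. x * y \<in> S \<longrightarrow> x \<in> S \<and> y \<in> S)"

definition preserves_orthogonality :: "'p::monoid_mult set \<Rightarrow> bool" where
  "preserves_orthogonality S \<longleftrightarrow> (\<forall>x\<in>S. \<forall>y\<in>S.
     (rideal S x \<inter> rideal S y = {}) \<longleftrightarrow> (rideal UNIV x \<inter> rideal UNIV y = {}))"

class complex_hilbert = ab_group_add +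
  fixes scaleC :: "complex \<Rightarrow> 'a \<Rightarrow> 'a"
    and cinner :: "'a \<Rightarrow> 'a \<Rightarrow> complex"
  assumes scaleC_add_right: "scaleC a (x + y) = scaleC a x + scaleC a y"
    and scaleC_add_left: "scaleC (a + b) x = scaleC a x + scaleC b x"
    and scaleC_scaleC: "scaleC a (scaleC b x) = scaleC (a * b) x"
    and scaleC_one: "scaleC 1 x = x"
    and cinner_conj: "cinner y x = cnj (cinner x y)"
    and cinner_add_left: "cinner (x + y) z = cinner x z + cinner y z"
    and cinner_scaleC_left: "cinner (scaleC a x) y = a * cinner x y"
    and cinner_pos: "x \<noteq> 0 \<Longrightarrow> 0 < Re (cinner x x)"
    and cinner_complete:
      "(\<forall>e>0. \<exists>N. \<forall>m\<ge>N. \<forall>n\<ge>N. Re (cinner (X m - X n) (X m - X n)) < e)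
        \<Longrightarrow> \<exists>L. (\<lambda>n. Re (cinner (X n - L) (X n - L))) \<longlonglongrightarrow> 0"

definition lin_on :: "'v::ab_group_add set \<Rightarrow> (complex \<Rightarrow> 'v \<Rightarrow> 'v) \<Rightarrow> ('v \<Rightarrow> 'v) \<Rightarrow> bool" where
  "lin_on C sc T \<longleftrightarrow> (\<forall>x\<in>C. T x \<in> C) \<and> (\<forall>x\<in>C. \<forall>y\<in>C. T (x + y) = T x + T y)
     \<and> (\<forall>a. \<forall>x\<in>C. T (sc a x) = sc a (T x))"

definition bounded_op_on :: "'v::ab_group_add set \<Rightarrow> (complex \<Rightarrow> 'v \<Rightarrow> 'v) \<Rightarrow> ('v \<Rightarrow> 'v \<Rightarrow> complex)
    \<Rightarrow> ('v \<Rightarrow> 'v) \<Rightarrow> bool" where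
  "bounded_op_on C sc ip T \<longleftrightarrow> lin_on C sc T \<and>
     (\<exists>c. \<forall>x\<in>C. Re (ip (T x) (T x)) \<le> c * Re (ip x x))"

definition isometry_on :: "'v::ab_group_add set \<Rightarrow> (complex \<Rightarrow> 'v \<Rightarrow> 'v) \<Rightarrow> ('v \<Rightarrow> 'v \<Rightarrow> complex)
    \<Rightarrow> ('v \<Rightarrow> 'v) \<Rightarrow> bool" where
  "isometry_on C sc ip T \<longleftrightarrow> lin_on C sc T \<and> (\<forall>x\<in>C. ip (T x) (T x) = ip x x)"

definition adjoint_on :: "'v set \<Rightarrow> ('v \<Rightarrow> 'v \<Rightarrow> complex) \<Rightarrow> ('v \<Rightarrow> 'v) \<Rightarrow> ('v \<Rightarrow> 'v) \<Rightarrow> bool" where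
  "adjoint_on C ip T S \<longleftrightarrow> (\<forall>y\<in>C. S y \<in> C) \<and> (\<forall>x\<in>C. \<forall>y\<in>C. ip (T x) y = ip x (S y))"

definition adj :: "'v set \<Rightarrow> ('v \<Rightarrow> 'v \<Rightarrow> complex) \<Rightarrow> ('v \<Rightarrow> 'v) \<Rightarrow> ('v \<Rightarrow> 'v)" where
  "adj C ip T = (SOME S. adjoint_on C ip T S)"

definition nica_rep :: "'v::ab_group_add set \<Rightarrow> (complex \<Rightarrow> 'v \<Rightarrow> 'v) \<Rightarrow> ('v \<Rightarrow> 'v \<Rightarrow> complex)
    \<Rightarrow> 'p::monoid_mult set \<Rightarrow> ('p \<Rightarrow> 'v \<Rightarrow> 'v) \<Rightarrow> bool" where
  "nica_rep C sc ip S V \<longleftrightarrow>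
     (\<forall>k\<in>C. V 1 k = k) \<and>
     (\<forall>p\<in>S. \<forall>q\<in>S. \<forall>k\<in>C. V (p * q) k = V p (V q k)) \<and>
     (\<forall>p\<in>S. isometry_on C sc ip (V p)) \<and>
     (\<forall>x\<in>S. \<forall>y\<in>S.
        (join_in S x y = {} \<longrightarrow>
           (\<forall>k\<in>C. V x (adj C ip (V x) (V y (adj C ip (V y) k))) = 0)) \<and>
        (\<forall>r\<in>join_in S x y. \<forall>k\<in>C.
           V x (adj C ip (V x) (V y (adj C ip (V y) k))) = V r (adj C ip (V r) k)))"

definition orth_proj :: "('v::ab_group_add \<Rightarrow> 'v \<Rightarrow> complex) \<Rightarrow> 'v set \<Rightarrow> 'v \<Rightarrow> 'v" where
  "orth_proj ip M k = (THE m. m \<in> M \<and> (\<forall>m'\<in>M. ip m' (k - m) = 0))"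

definition l2sc :: "complex \<Rightarrow> ('i \<Rightarrow> 'h::complex_hilbert) \<Rightarrow> ('i \<Rightarrow> 'h)" where
  "l2sc a f = (\<lambda>i. scaleC a (f i))"

definition l2 :: "('i \<Rightarrow> 'h::complex_hilbert) set" where
  "l2 = {f. (\<lambda>i. Re (cinner (f i) (f i))) summable_on UNIV}"

definition l2inner :: "('i \<Rightarrow> 'h::complex_hilbert) \<Rightarrow> ('i \<Rightarrow> 'h) \<Rightarrow> complex" where
  "l2inner f g = (\<Sum>\<^sub>\<infinity>i. cinner (f i) (g i))"

definition l2_hilbert_subspace :: "('i \<Rightarrow> 'h::complex_hilbert) set \<Rightarrow> bool" where
  "l2_hilbert_subspace K \<longleftrightarrow> K \<subseteq> l2 \<and> 0 \<in> K \<and>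
     (\<forall>f\<in>K. \<forall>g\<in>K. f + g \<in> K) \<and> (\<forall>a. \<forall>f\<in>K. l2sc a f \<in> K) \<and>
     (\<forall>X. (\<forall>n. X n \<in> K) \<longrightarrow>
        (\<forall>e>0. \<exists>N. \<forall>m\<ge>N. \<forall>n\<ge>N. Re (l2inner (X m - X n) (X m - X n)) < e) \<longrightarrow>
        (\<exists>L\<in>K. (\<lambda>n. Re (l2inner (X n - L) (X n - L))) \<longlonglongrightarrow> 0))"

end

theory Submission
  imports Defs
begin

text \<open>A vector \<open>k\<close> of the dilation space is encoded by the function sending \<open>s\<close> to the component
  of \<open>W\<^sub>s\<^sup>* k\<close> in \<open>H\<close>; these are the functions \<open>F : P \<rightarrow> H\<close> with \<open>F (s a) = V\<^sub>a\<^sup>* F s\<close> for \<open>a \<in> P1\<close>.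
  In this picture \<open>W\<^sub>p\<^sup>*\<close> is the shift \<open>F \<mapsto> F (p _)\<close>, \<open>W\<^sub>p\<close> has an explicit formula, and
  \<open>W\<^sub>p W\<^sub>p\<^sup>*\<close> acts pointwise by range projections of \<open>V\<close>, so that Nica covariance is inherited
  from \<open>V\<close>. The norm comes from a well-order on an index set: since the projections onto the
  subspaces \<open>W\<^sub>s H\<close> commute, a transfinite Gram-Schmidt process splits the dilation space
  orthogonally into pieces \<open>W\<^sub>s L\<^sub>s\<close> with \<open>L\<^sub>s \<subseteq> H\<close>, which realises it inside an \<open>\<ell>\<^sup>2\<close> sum of
  copies of \<open>H\<close>. The norm does not depend on the well-order because the family of the vectors
  \<open>W\<^sub>s h\<close> has the reproducing property \<open>\<langle>W\<^sub>s h, F\<rangle> = \<langle>h, F s\<rangle>\<close>; this makes the shift and \<open>W\<^sub>p\<close>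
  contractions, and as the shift is a left inverse of \<open>W\<^sub>p\<close>, they are mutually adjoint.\<close>

section \<open>Hilbert space geometry\<close>

abbreviation nsq :: "'h::complex_hilbert \<Rightarrow> real" where
  "nsq x \<equiv> Re (cinner x x)"

lemma cinner_zero_left [simp]: "cinner 0 y = 0"
  using cinner_add_left[of 0 0 y] by simp

lemma cinner_zero_right [simp]: "cinner x 0 = 0"
  by (metis cinner_conj cinner_zero_left complex_cnj_zero)

lemma cinner_minus_left: "cinner (- x) y = - cinner x y"
  using cinner_add_left[of x "- x" y] by (simp add: eq_neg_iff_add_eq_0 add.commute)

lemma cinner_diff_left: "cinner (x - y) z = cinner x z - cinner y z"
  using cinner_add_left[of x "- y" z] by (simp add: cinner_minus_left)

lemma cinner_add_right: "cinner x (y + z) = cinner x y + cinner x z"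
  by (metis cinner_add_left cinner_conj complex_cnj_add)

lemma cinner_diff_right: "cinner x (y - z) = cinner x y - cinner x z"
  by (metis cinner_diff_left cinner_conj complex_cnj_diff)

lemma cinner_scaleC_right: "cinner x (scaleC a y) = cnj a * cinner x y"
  by (metis cinner_scaleC_left cinner_conj complex_cnj_mult)

lemma cinner_sum_left: "cinner (sum f S) y = (\<Sum>i\<in>S. cinner (f i) y)"
  by (induction S rule: infinite_finite_induct) (auto simp: cinner_add_left)

lemma cinner_sum_right: "cinner y (sum f S) = (\<Sum>i\<in>S. cinner y (f i))"
  by (induction S rule: infinite_finite_induct) (auto simp: cinner_add_right)

lemma nsq_nonneg [simp]: "nsq x \<ge> 0"
  by (cases "x = 0") (auto simp: cinner_pos less_imp_le)

lemma nsq_eq_0_iff [simp]: "nsq x = 0 \<longleftrightarrow> x = 0"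
  using cinner_pos[of x] by (cases "x = 0") auto

lemma cinner_self: "cinner x x = of_real (nsq x)"
proof -
  have "Im (cinner x x) = - Im (cinner x x)"
    by (subst (1) cinner_conj) simp
  then show ?thesis by (simp add: complex_eq_iff)
qed

lemma Re_cinner_commute: "Re (cinner y x) = Re (cinner x y)"
  by (subst cinner_conj) simp

lemma scaleC_minus_one: "scaleC (-1) x = - x"
proof -
  have "cinner (scaleC (-1) x + x) (scaleC (-1) x + x) = 0"
    by (simp add: cinner_add_left cinner_add_right cinner_scaleC_left cinner_scaleC_right)
  then have "scaleC (-1) x + x = 0" by (metis nsq_eq_0_iff zero_complex.simps(1))
  then show ?thesis by (simp add: eq_neg_iff_add_eq_0)
qed

lemma scaleC_zero_right [simp]: "scaleC a 0 = 0"
  using scaleC_add_right[of a 0 0] by simp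

lemma scaleC_diff_right: "scaleC a (x - y) = scaleC a x - scaleC a y"
  using scaleC_add_right[of a "x - y" y] by simp

lemma nsq_add: "nsq (x + y) = nsq x + nsq y + 2 * Re (cinner x y)"
  using Re_cinner_commute[of x y] by (simp add: cinner_add_left cinner_add_right)

lemma nsq_diff: "nsq (x - y) = nsq x + nsq y - 2 * Re (cinner x y)"
  using Re_cinner_commute[of x y] by (simp add: cinner_diff_left cinner_diff_right)

lemma nsq_scaleC: "nsq (scaleC a x) = (cmod a)\<^sup>2 * nsq x"
proof -
  have "cinner (scaleC a x) (scaleC a x) = (a * cnj a) * cinner x x"
    by (simp add: cinner_scaleC_left cinner_scaleC_right)
  then show ?thesis by (simp add: complex_norm_square[symmetric] flip: of_real_power)
qed

lemma nsq_add_le: "nsq (x + y) \<le> 2 * nsq x + 2 * nsq y"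
  using nsq_nonneg[of "x - y"] unfolding nsq_add nsq_diff by linarith

lemma nsq_diff_le: "nsq (x - z) \<le> 2 * nsq (x - y) + 2 * nsq (y - z)"
  using nsq_add_le[of "x - y" "y - z"] by simp

lemma nsq_minus_commute: "nsq (x - y) = nsq (y - x)"
  using Re_cinner_commute[of x y] by (simp add: nsq_diff)

lemma cinner_eqI: "(\<And>h. cinner h x = cinner h y) \<Longrightarrow> x = y"
  by (metis cinner_diff_right eq_iff_diff_eq_0 nsq_eq_0_iff zero_complex.simps(1))

text \<open>For \<open>t\<close> a small negative multiple of \<open>z\<close> the linear term
  outweighs the quadratic one. Orthogonality is deduced from norm minimality in this way.\<close>

lemma zero_if_quadratic_nonneg:
  fixes z :: complex
  assumes "\<And>t. 0 \<le> 2 * Re (cnj t * z) + (cmod t)\<^sup>2 * N" and "N \<ge> 0"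
  shows "z = 0"
proof (rule ccontr)
  assume "z \<noteq> 0"
  define e where "e = 1 / (N + 1)"
  have e: "e > 0" "e * N < 1" using assms(2) by (auto simp: e_def field_simps)
  have "0 \<le> 2 * Re (cnj (- of_real e * z) * z) + (cmod (- of_real e * z))\<^sup>2 * N" by (rule assms)
  also have "\<dots> = - (2 * e * (cmod z)\<^sup>2) + e * e * N * (cmod z)\<^sup>2"
  proof -
    have "cnj (- of_real e * z) * z = of_real (- e * (cmod z)\<^sup>2)"
      using complex_norm_square[of z] by (simp add: algebra_simps)
    then have "Re (cnj (- of_real e * z) * z) = - e * (cmod z)\<^sup>2" by (metis Re_complex_of_real)
    then show ?thesis using e by (simp add: norm_mult power2_eq_square algebra_simps)
  qed
  also have "\<dots> = e * (cmod z)\<^sup>2 * (e * N - 2)" by (simp add: algebra_simps)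
  also have "\<dots> < 0" using e \<open>z \<noteq> 0\<close> by (intro mult_pos_neg) auto
  finally show False by simp
qed

text \<open>Cauchy-Schwarz in weighted form, which keeps square roots of \<open>nsq\<close> out of
  later estimates. A unit scalar \<open>u\<close> rotates the inner product to its modulus, and then
  the square of \<open>t u x - y\<close> is expanded.\<close>

lemma cinner_bound: "t > 0 \<Longrightarrow> 2 * cmod (cinner x y) \<le> t * nsq x + nsq y / t"
proof -
  assume t: "t > 0"
  obtain u where u: "cmod u = 1" "u * cinner x y = of_real (cmod (cinner x y))"
  proof (cases "cinner x y = 0")
    case True then show ?thesis using that[of 1] by simp
  next
    case False
    have "cnj (cinner x y) * cinner x y = of_real ((cmod (cinner x y))\<^sup>2)"
      using complex_norm_square[of "cinner x y"] by (simp add: mult.commute)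
    then show ?thesis using False
      by (intro that[of "cnj (cinner x y) / of_real (cmod (cinner x y))"])
         (auto simp: norm_divide power2_eq_square)
  qed
  have "0 \<le> nsq (scaleC (of_real t * u) x - y)" by simp
  also have "\<dots> = t\<^sup>2 * nsq x + nsq y - 2 * t * cmod (cinner x y)"
    unfolding nsq_diff nsq_scaleC using u t by (simp add: norm_mult cinner_scaleC_left mult.assoc)
  finally have "2 * t * cmod (cinner x y) \<le> t\<^sup>2 * nsq x + nsq y" by simp
  then have "2 * t * cmod (cinner x y) / t \<le> (t\<^sup>2 * nsq x + nsq y) / t"
    using t by (intro divide_right_mono) auto
  then show ?thesis using t by (simp add: field_simps power2_eq_square)
qed

section \<open>Closed subspaces and orthogonal projections\<close>

definition closed_subspace :: "'h::complex_hilbert set \<Rightarrow> bool" where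
  "closed_subspace M \<longleftrightarrow> 0 \<in> M \<and> (\<forall>x\<in>M. \<forall>y\<in>M. x + y \<in> M) \<and> (\<forall>a. \<forall>x\<in>M. scaleC a x \<in> M) \<and>
     (\<forall>X L. (\<forall>n. X n \<in> M) \<longrightarrow> (\<lambda>n. nsq (X n - L)) \<longlonglongrightarrow> 0 \<longrightarrow> L \<in> M)"

lemma closed_subspaceD:
  assumes "closed_subspace M"
  shows "0 \<in> M" "x \<in> M \<Longrightarrow> y \<in> M \<Longrightarrow> x + y \<in> M" "x \<in> M \<Longrightarrow> scaleC a x \<in> M"
    "x \<in> M \<Longrightarrow> y \<in> M \<Longrightarrow> x - y \<in> M"
    "(\<And>n. X n \<in> M) \<Longrightarrow> (\<lambda>n. nsq (X n - L)) \<longlonglongrightarrow> 0 \<Longrightarrow> L \<in> M"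
proof -
  show "x - y \<in> M" if "x \<in> M" "y \<in> M"
    using assms that scaleC_minus_one[of y] unfolding closed_subspace_def
    by (metis add_uminus_conv_diff)
  show "L \<in> M" if "\<And>n. X n \<in> M" "(\<lambda>n. nsq (X n - L)) \<longlonglongrightarrow> 0"
    using assms that unfolding closed_subspace_def by blast
qed (use assms in \<open>auto simp: closed_subspace_def\<close>)

text \<open>By the parallelogram law a minimising sequence for the distance from \<open>x\<close> to
  \<open>M\<close> is Cauchy; its limit is a nearest point, and perturbing it inside
  \<open>M\<close> yields orthogonality.\<close>

lemma projection_exists:
  assumes M: "closed_subspace M"
  shows "\<exists>m\<in>M. \<forall>m'\<in>M. cinner m' (x - m) = 0"
proof -
  define D where "D = (\<lambda>m. nsq (x - m)) ` M"
  define d where "d = Inf D"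
  have ne: "D \<noteq> {}" using closed_subspaceD(1)[OF M] by (auto simp: D_def)
  have bdd: "bdd_below D" by (auto simp: D_def intro!: bdd_belowI[of _ 0])
  have d_le: "d \<le> nsq (x - m)" if "m \<in> M" for m
    unfolding d_def using that bdd by (intro cInf_lower) (auto simp: D_def)
  have "\<exists>m\<in>M. nsq (x - m) < d + inverse (Suc n)" for n
    using cInf_lessD[OF ne, of "d + inverse (Suc n)"] unfolding d_def D_def by auto
  then obtain X where X: "\<And>n. X n \<in> M" "\<And>n. nsq (x - X n) < d + inverse (Suc n)" by metis
  have half: "nsq (X m - X n) \<le> 2 * inverse (Suc m) + 2 * inverse (Suc n)" for m n
  proof -
    \<comment> \<open>The midpoint lies in \<open>M\<close>, so \<open>d\<close> bounds its squared
      distance from \<open>x\<close> from below in the parallelogram identity.\<close>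
    define z where "z = scaleC (1/2) (X m + X n)"
    have z: "z \<in> M" unfolding z_def using X by (intro closed_subspaceD(2,3)[OF M])
    have "(x - X m) + (x - X n) = scaleC 2 (x - z)"
    proof -
      have "scaleC 2 z = X m + X n" by (simp add: z_def scaleC_scaleC scaleC_one)
      moreover have "scaleC 2 x = x + x" using scaleC_add_left[of 1 1 x] by (simp add: scaleC_one)
      ultimately show ?thesis by (simp add: scaleC_diff_right algebra_simps)
    qed
    then have "nsq ((x - X m) + (x - X n)) = 4 * nsq (x - z)" by (simp add: nsq_scaleC)
    moreover have "nsq ((x - X m) - (x - X n)) = nsq (X m - X n)"
      using nsq_minus_commute[of "X m" "X n"] by simp
    ultimately have "nsq (X m - X n) = 2 * nsq (x - X m) + 2 * nsq (x - X n) - 4 * nsq (x - z)"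
      unfolding nsq_add nsq_diff[of "x - X m" "x - X n"] by linarith
    then show ?thesis using X(2)[of m] X(2)[of n] d_le[OF z] by linarith
  qed
  have "\<forall>e>0. \<exists>N. \<forall>m\<ge>N. \<forall>n\<ge>N. nsq (X m - X n) < e"
  proof (intro allI impI)
    fix e :: real assume "e > 0"
    then obtain N where N: "inverse (Suc N) < e / 4" using reals_Archimedean[of "e/4"] by auto
    have "nsq (X m - X n) < e" if "m \<ge> N" "n \<ge> N" for m n
    proof -
      have "inverse (real (Suc m)) \<le> inverse (Suc N)" "inverse (real (Suc n)) \<le> inverse (Suc N)"
        using that by (auto intro!: le_imp_inverse_le)
      then show ?thesis using half[of m n] N by linarith
    qed
    then show "\<exists>N. \<forall>m\<ge>N. \<forall>n\<ge>N. nsq (X m - X n) < e" by blast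
  qed
  then obtain L where L: "(\<lambda>n. nsq (X n - L)) \<longlonglongrightarrow> 0" using cinner_complete[of X] by blast
  have LM: "L \<in> M" using closed_subspaceD(5)[OF M X(1) L] .
  have Ld: "nsq (x - L) \<le> d"
  proof (rule field_le_epsilon)
    fix e :: real assume e: "e > 0"
    \<comment> \<open>With only squared norms at hand, the cross term is split with weight
      \<open>t\<close>, so small that the bound \<open>d + 2\<close> on \<open>nsq (x - X n)\<close>
      costs \<open>e / 2\<close>.\<close>
    define t where "t = e / (2 * (d + 2))"
    have d0: "d \<ge> 0" unfolding d_def using ne by (intro cInf_greatest) (auto simp: D_def)
    have t: "t > 0" "t * (d + 2) = e / 2" using e d0 by (auto simp: t_def field_simps)
    have "(\<lambda>n. inverse (real (Suc n)) + (1 + 1 / t) * nsq (X n - L)) \<longlonglongrightarrow> 0 + (1 + 1/t) * 0"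
      by (intro tendsto_intros L LIMSEQ_inverse_real_of_nat)
    then have "eventually (\<lambda>n. inverse (real (Suc n)) + (1 + 1 / t) * nsq (X n - L) < e/2) sequentially"
      using e by (auto dest!: order_tendstoD(2)[where a = "e/2"])
    then obtain n where n: "inverse (real (Suc n)) + (1 + 1 / t) * nsq (X n - L) < e/2"
      by (auto simp: eventually_sequentially)
    have "nsq (x - L) = nsq (x - X n) + nsq (X n - L) + 2 * Re (cinner (x - X n) (X n - L))"
      using nsq_add[of "x - X n" "X n - L"] by simp
    also have "\<dots> \<le> nsq (x - X n) + nsq (X n - L) + (t * nsq (x - X n) + nsq (X n - L) / t)"
      using cinner_bound[OF t(1), of "x - X n" "X n - L"] complex_Re_le_cmod[of "cinner (x - X n) (X n - L)"]
      by linarith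
    also have "\<dots> \<le> d + inverse (Suc n) + t * (d + 2) + (1 + 1/t) * nsq (X n - L)"
    proof -
      have "inverse (real (Suc n)) \<le> 1" by (simp add: field_simps)
      then have "nsq (x - X n) \<le> d + 2" using X(2)[of n] by linarith
      then have "t * nsq (x - X n) \<le> t * (d + 2)" using t by (intro mult_left_mono) auto
      then show ?thesis using X(2)[of n] by (simp add: algebra_simps)
    qed
    also have "\<dots> \<le> d + e" using n t by linarith
    finally show "nsq (x - L) \<le> d + e" .
  qed
  have "cinner m (x - L) = 0" if m: "m \<in> M" for m
  proof -
    have "0 \<le> 2 * Re (cnj t * cinner (x - L) m) + (cmod t)\<^sup>2 * nsq m" for t
    proof -
      have "L - scaleC t m \<in> M" using LM m by (intro closed_subspaceD(3,4)[OF M])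
      then have "nsq (x - L) \<le> nsq (x - L + scaleC t m)"
        using d_le[of "L - scaleC t m"] Ld by (simp add: algebra_simps)
      then show ?thesis unfolding nsq_add nsq_scaleC by (simp add: cinner_scaleC_right)
    qed
    then have "cinner (x - L) m = 0" by (rule zero_if_quadratic_nonneg) simp
    then show ?thesis using cinner_conj[of m "x - L"] by simp
  qed
  then show ?thesis using LM by blast
qed

definition proj :: "'h::complex_hilbert set \<Rightarrow> 'h \<Rightarrow> 'h" where
  "proj M x = (SOME m. m \<in> M \<and> (\<forall>m'\<in>M. cinner m' (x - m) = 0))"

lemma
  assumes "closed_subspace M"
  shows proj_in: "proj M x \<in> M" and proj_orth: "m \<in> M \<Longrightarrow> cinner m (x - proj M x) = 0"
proof -
  have *: "proj M x \<in> M \<and> (\<forall>m'\<in>M. cinner m' (x - proj M x) = 0)"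
    unfolding proj_def by (rule someI_ex) (use projection_exists[OF assms] in blast)
  show "proj M x \<in> M" "m \<in> M \<Longrightarrow> cinner m (x - proj M x) = 0" using * by auto
qed

lemma proj_eqI:
  assumes M: "closed_subspace M" and m: "m \<in> M" and o: "\<And>m'. m' \<in> M \<Longrightarrow> cinner m' (x - m) = 0"
  shows "proj M x = m"
proof -
  define e where "e = proj M x - m"
  have e: "e \<in> M" unfolding e_def using proj_in[OF M] m by (intro closed_subspaceD(4)[OF M])
  have "cinner e e = cinner e (x - m) - cinner e (x - proj M x)"
    by (simp add: e_def cinner_diff_right)
  then have "cinner e e = 0" using e o proj_orth[OF M e] by simp
  then have "e = 0" by (metis nsq_eq_0_iff zero_complex.simps(1))
  then show ?thesis by (simp add: e_def)
qed

lemma proj_add: "closed_subspace M \<Longrightarrow> proj M (x + y) = proj M x + proj M y"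
  by (rule proj_eqI)
     (auto intro!: closed_subspaceD(2,3) proj_in simp: proj_orth add_diff_add cinner_add_right)

lemma proj_scaleC: "closed_subspace M \<Longrightarrow> proj M (scaleC a x) = scaleC a (proj M x)"
  by (rule proj_eqI)
     (auto intro!: closed_subspaceD(2,3) proj_in
           simp: proj_orth cinner_scaleC_right simp flip: scaleC_diff_right)

lemma proj_id: "closed_subspace M \<Longrightarrow> x \<in> M \<Longrightarrow> proj M x = x"
  by (rule proj_eqI) auto

lemma proj_diff: "closed_subspace M \<Longrightarrow> proj M (x - y) = proj M x - proj M y"
  using proj_add[of M "x - y" y] by simp

lemma proj_zero: "closed_subspace M \<Longrightarrow> proj M 0 = 0"
  by (simp add: proj_id closed_subspaceD(1))

lemma cinner_proj_left:
  "closed_subspace M \<Longrightarrow> y \<in> M \<Longrightarrow> cinner y (proj M x) = cinner y x"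
  using proj_orth[of M y x] by (simp add: cinner_diff_right)

lemma nsq_proj_le:
  assumes "closed_subspace M" shows "nsq (proj M x) \<le> nsq x"
proof -
  have "nsq x = nsq (proj M x + (x - proj M x))" by simp
  also have "\<dots> = nsq (proj M x) + nsq (x - proj M x)"
    unfolding nsq_add by (simp add: proj_orth[OF assms proj_in[OF assms]])
  finally show ?thesis by simp
qed

lemma closed_subspace_eq_UNIV:
  assumes "closed_subspace M" "\<And>x. (\<And>m. m \<in> M \<Longrightarrow> cinner m x = 0) \<Longrightarrow> x = 0"
  shows "x \<in> M"
proof -
  have "x - proj M x = 0" using proj_orth[OF assms(1)] by (intro assms(2)) auto
  then show ?thesis using proj_in[OF assms(1), of x] by simp
qed

lemma nsq_limit_unique:
  assumes "(\<lambda>n. nsq (X n - L)) \<longlonglongrightarrow> 0" "(\<lambda>n. nsq (X n - L')) \<longlonglongrightarrow> 0"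
  shows "L = L'"
proof -
  have "(\<lambda>n. 2 * nsq (X n - L) + 2 * nsq (X n - L')) \<longlonglongrightarrow> 2 * 0 + 2 * 0"
    by (intro tendsto_intros assms)
  moreover have "nsq (L - L') \<le> 2 * nsq (X n - L) + 2 * nsq (X n - L')" for n
    using nsq_diff_le[of L L' "X n"] nsq_minus_commute[of L "X n"] by simp
  ultimately have "nsq (L - L') \<le> 0" by (intro LIMSEQ_le_const[where X = "\<lambda>n. 2 * nsq (X n - L) + 2 * nsq (X n - L')"]) auto
  then have "nsq (L - L') = 0" using nsq_nonneg[of "L - L'"] by linarith
  then show ?thesis by simp
qed

text \<open>The set of vectors satisfying the identity is a closed subspace containing the range of
  each \<open>R i\<close>, hence with trivial orthogonal complement.\<close>
lemma orthogonal_projections_parseval: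
  fixes R :: "'i \<Rightarrow> 'h::complex_hilbert \<Rightarrow> 'h"
  assumes add: "\<And>i x y. R i (x + y) = R i x + R i y"
    and sc: "\<And>i a x. R i (scaleC a x) = scaleC a (R i x)"
    and sa: "\<And>i x y. cinner (R i x) y = cinner x (R i y)"
    and idem: "\<And>i x. R i (R i x) = R i x"
    and orth: "\<And>i j x. i \<noteq> j \<Longrightarrow> R i (R j x) = 0"
    and total: "\<And>x. (\<And>i. R i x = 0) \<Longrightarrow> x = 0"
  shows "((\<lambda>i. cinner (R i x) y) has_sum cinner x y) UNIV"
proof -
  define Y where "Y = {x. \<forall>y. ((\<lambda>i. cinner (R i x) y) has_sum cinner x y) UNIV}"
  have R0: "R i 0 = 0" for i using add[of i 0 0] by simp
  have Rdiff: "R i (x - y) = R i x - R i y" for i x y using add[of i "x - y" y] by simp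
  \<comment> \<open>The partial sum is an orthogonal projection of \<open>x\<close>, so Pythagoras
    bounds it.\<close>
  have bessel: "nsq (\<Sum>i\<in>S. R i x) \<le> nsq x" if "finite S" for S x
  proof -
    define p where "p = (\<Sum>i\<in>S. R i x)"
    have "R i p = (if i \<in> S then R i x else 0)" for i
    proof -
      have "R i p = (\<Sum>j\<in>S. R i (R j x))"
        unfolding p_def by (induction S rule: infinite_finite_induct) (auto simp: R0 add)
      also have "\<dots> = (\<Sum>j\<in>S. if j = i then R i x else 0)"
        by (intro sum.cong refl) (auto simp: idem orth)
      finally show ?thesis using that by simp
    qed
    then have "cinner p x = (\<Sum>i\<in>S. cinner (R i p) x)"
      by (simp add: p_def cinner_sum_left)
    also have "\<dots> = (\<Sum>i\<in>S. cinner p (R i x))" by (simp add: sa)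
    also have "\<dots> = cinner p p" by (simp add: p_def cinner_sum_right)
    finally have "cinner p x = cinner p p" .
    then have "nsq (x - p) = nsq x - nsq p"
      using Re_cinner_commute[of x p] by (simp add: nsq_diff)
    then show ?thesis using nsq_nonneg[of "x - p"] by (simp add: p_def)
  qed
  have cl: "closed_subspace Y"
    unfolding closed_subspace_def
  proof (intro conjI ballI allI impI)
    show "0 \<in> Y" by (simp add: Y_def R0)
    show "x + y \<in> Y" if "x \<in> Y" "y \<in> Y" for x y
      using that by (auto simp: Y_def add cinner_add_left intro!: has_sum_add)
    show "scaleC a x \<in> Y" if "x \<in> Y" for a x
      using that by (auto simp: Y_def sc cinner_scaleC_left intro!: has_sum_cmult_right)
    fix X L assume X: "\<forall>n. X n \<in> Y" and lim: "(\<lambda>n. nsq (X n - L)) \<longlonglongrightarrow> 0"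
    show "L \<in> Y"
      unfolding Y_def has_sum_def tendsto_iff dist_norm
    proof (intro CollectI allI impI)
      fix y :: 'h and e :: real assume e: "e > 0"
      define t where "t = 2 * (nsq y + 1) / e"
      have "nsq y + 1 > 0" by (rule add_nonneg_pos) simp_all
      then have t0: "t > 0" using e unfolding t_def by (intro divide_pos_pos mult_pos_pos) simp_all
      moreover have "e / 2 * t = nsq y + 1" using e by (simp add: t_def)
      ultimately have t: "t > 0" "nsq y / t < e / 2"
        unfolding pos_divide_less_eq[OF t0] by simp_all
      have "(\<lambda>n. t * (4 * nsq (X n - L))) \<longlonglongrightarrow> t * (4 * 0)" by (intro tendsto_intros lim)
      then have "eventually (\<lambda>n. t * (4 * nsq (X n - L)) < e / 2) sequentially"
        using e by (auto dest!: order_tendstoD(2)[where a = "e / 2"])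
      then obtain n where n: "t * (4 * nsq (X n - L)) < e / 2"
        by (auto simp: eventually_sequentially)
      \<comment> \<open>By Bessel's inequality, replacing \<open>L\<close> with \<open>X n\<close>
        changes the error by less than \<open>e / 2\<close>, uniformly in \<open>S\<close>; hence
        one \<open>n\<close> serves for all partial sums.\<close>
      have diff: "norm ((\<Sum>i\<in>S. cinner (R i L) y) - cinner L y -
            ((\<Sum>i\<in>S. cinner (R i (X n)) y) - cinner (X n) y)) < e / 2" if S: "finite S" for S
      proof -
        define v where "v = (\<Sum>i\<in>S. R i (L - X n)) - (L - X n)"
        have v: "(\<Sum>i\<in>S. cinner (R i L) y) - cinner L y - ((\<Sum>i\<in>S. cinner (R i (X n)) y) - cinner (X n) y)
          = cinner v y"
          by (simp add: v_def Rdiff cinner_diff_left cinner_sum_left sum_subtractf)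
        have "nsq v \<le> 2 * nsq (\<Sum>i\<in>S. R i (L - X n)) + 2 * nsq (L - X n)"
          using nsq_diff_le[of "\<Sum>i\<in>S. R i (L - X n)" "L - X n" 0] nsq_minus_commute[of L "X n"]
          unfolding v_def by simp
        then have "nsq v \<le> 4 * nsq (X n - L)"
          using bessel[OF S, of "L - X n"] nsq_minus_commute[of L "X n"] by simp
        then have "t * nsq v \<le> t * (4 * nsq (X n - L))" using t by (intro mult_left_mono) auto
        moreover have "2 * cmod (cinner v y) \<le> t * nsq v + nsq y / t" by (rule cinner_bound[OF t(1)])
        ultimately have "cmod (cinner v y) < e / 2" using n t(2) by linarith
        then show ?thesis unfolding v .
      qed
      have "((\<lambda>i. cinner (R i (X n)) y) has_sum cinner (X n) y) UNIV"
        using X by (auto simp: Y_def)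
      then have "\<forall>\<^sub>F S in finite_subsets_at_top UNIV.
          norm ((\<Sum>i\<in>S. cinner (R i (X n)) y) - cinner (X n) y) < e/2"
        using half_gt_zero[OF e] unfolding has_sum_def tendsto_iff dist_norm by blast
      then have "\<forall>\<^sub>F S in finite_subsets_at_top UNIV. finite S \<and>
          norm ((\<Sum>i\<in>S. cinner (R i (X n)) y) - cinner (X n) y) < e/2"
        by (rule eventually_conj[rotated]) (rule eventually_finite_subsets_at_top_weakI)
      then show "\<forall>\<^sub>F S in finite_subsets_at_top UNIV. norm ((\<Sum>i\<in>S. cinner (R i L) y) - cinner L y) < e"
      proof (rule eventually_mono)
        fix S assume S: "finite S \<and> norm ((\<Sum>i\<in>S. cinner (R i (X n)) y) - cinner (X n) y) < e/2"
        then show "norm ((\<Sum>i\<in>S. cinner (R i L) y) - cinner L y) < e"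
          using diff[of S] norm_triangle_sub
            [of "(\<Sum>i\<in>S. cinner (R i L) y) - cinner L y" "(\<Sum>i\<in>S. cinner (R i (X n)) y) - cinner (X n) y"]
          by linarith
      qed
    qed
  qed
  have RY: "R j z \<in> Y" for j z
    unfolding Y_def
  proof (intro CollectI allI)
    fix y
    have "((\<lambda>i. cinner (R i (R j z)) y) has_sum cinner (R j z) y) {j}"
      using has_sum_finite[of "{j}" "\<lambda>i. cinner (R i (R j z)) y"] by (simp add: idem)
    then show "((\<lambda>i. cinner (R i (R j z)) y) has_sum cinner (R j z) y) UNIV"
      by (rule has_sum_cong_neutral[THEN iffD1, rotated -1]) (auto simp: orth)
  qed
  have "z = 0" if z: "\<And>m. m \<in> Y \<Longrightarrow> cinner m z = 0" for z
  proof (rule total)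
    fix i
    show "R i z = 0"
      using z RY by (intro cinner_eqI) (simp flip: sa)
  qed
  with cl have "x \<in> Y" by (rule closed_subspace_eq_UNIV)
  then show ?thesis by (simp add: Y_def)
qed

section \<open>Isometries and their adjoints\<close>

lemma isometry_cinner:
  fixes T :: "'h::complex_hilbert \<Rightarrow> 'h"
  assumes T: "isometry_on UNIV scaleC cinner T"
  shows "cinner (T x) (T y) = cinner x y"
proof -
  have add: "T (x + y) = T x + T y" and sc: "T (scaleC a x) = scaleC a (T x)"
    and iso: "cinner (T x) (T x) = cinner x x" for x y a
    using T by (auto simp: isometry_on_def lin_on_def)
  have re: "Re (cinner (T x) (T y)) = Re (cinner x y)" for x y
    using nsq_add[of x y] nsq_add[of "T x" "T y"] by (simp flip: add add: iso)
  \<comment> \<open>Multiplying \<open>x\<close> by minus the imaginary unit turns imaginary parts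
    into real parts.\<close>
  have "Im (cinner (T x) (T y)) = Im (cinner x y)"
    using re[of "scaleC (- \<i>) x" y] by (simp add: sc cinner_scaleC_left)
  with re show ?thesis by (simp add: complex_eq_iff)
qed

text \<open>\<open>adj\<close> is a choice, so an adjoint has to be exhibited: the range of an
  isometry is closed, and projecting onto it and then inverting \<open>T\<close> gives one.\<close>

lemma isometry_adjoint:
  fixes T :: "'h::complex_hilbert \<Rightarrow> 'h"
  assumes T: "isometry_on UNIV scaleC cinner T"
  shows "adjoint_on UNIV cinner T (adj UNIV cinner T)"
proof -
  have add: "T (x + y) = T x + T y" and sc: "T (scaleC a x) = scaleC a (T x)" for x y a
    using T by (auto simp: isometry_on_def lin_on_def)
  have diff: "T (x - y) = T x - T y" for x y using add[of "x - y" y] by simp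
  have iso: "nsq (T x) = nsq x" for x using isometry_cinner[OF T] by simp
  have cl: "closed_subspace (range T)"
    unfolding closed_subspace_def
  proof (intro conjI ballI allI impI)
    show "0 \<in> range T" using diff[of 0 0] by (metis diff_self rangeI)
    show "x + y \<in> range T" if "x \<in> range T" "y \<in> range T" for x y
      using that by (auto simp flip: add)
    show "scaleC a x \<in> range T" if "x \<in> range T" for a x
      using that by (auto simp flip: sc)
    fix X L assume "\<forall>n. X n \<in> range T" and lim: "(\<lambda>n. nsq (X n - L)) \<longlonglongrightarrow> 0"
    then obtain Y where Y: "\<And>n. X n = T (Y n)" unfolding image_iff by metis
    have "\<forall>e>0. \<exists>N. \<forall>m\<ge>N. \<forall>n\<ge>N. nsq (Y m - Y n) < e"
    proof (intro allI impI)
      fix e :: real assume "e > 0"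
      then have "eventually (\<lambda>n. nsq (X n - L) < e / 4) sequentially"
        using lim by (auto dest!: order_tendstoD(2)[where a = "e / 4"])
      then obtain N where N: "\<And>n. n \<ge> N \<Longrightarrow> nsq (X n - L) < e / 4"
        by (auto simp: eventually_sequentially)
      have "nsq (Y m - Y n) < e" if "m \<ge> N" "n \<ge> N" for m n
      proof -
        have "nsq (Y m - Y n) = nsq (X m - X n)" using iso[of "Y m - Y n"] by (simp add: diff Y)
        also have "\<dots> \<le> 2 * nsq (X m - L) + 2 * nsq (X n - L)"
          using nsq_diff_le[of "X m" "X n" L] nsq_minus_commute[of L "X n"] by simp
        finally show ?thesis using N[OF that(1)] N[OF that(2)] by linarith
      qed
      then show "\<exists>N. \<forall>m\<ge>N. \<forall>n\<ge>N. nsq (Y m - Y n) < e" by blast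
    qed
    then obtain y where "(\<lambda>n. nsq (Y n - y)) \<longlonglongrightarrow> 0" using cinner_complete[of Y] by blast
    moreover have "nsq (X n - T y) = nsq (Y n - y)" for n
      using iso[of "Y n - y"] by (simp add: diff Y)
    ultimately have "L = T y" by (intro nsq_limit_unique[OF lim]) simp
    then show "L \<in> range T" by simp
  qed
  then have "\<exists>S. \<forall>y. proj (range T) y = T (S y)"
    using proj_in[OF cl] by (intro choice) (auto simp: image_iff)
  then obtain S where S: "\<And>y. proj (range T) y = T (S y)" by blast
  have "cinner (T x) y = cinner x (S y)" for x y
    using cinner_proj_left[OF cl, of "T x" y] by (simp add: S isometry_cinner[OF T])
  then have "adjoint_on UNIV cinner T S" by (simp add: adjoint_on_def)
  then show ?thesis unfolding adj_def by (rule someI[of "adjoint_on UNIV cinner T"])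
qed

section \<open>Square-summable families\<close>

lemma l2I:
  assumes "\<And>S. finite S \<Longrightarrow> (\<Sum>i\<in>S. nsq (f i)) \<le> C"
  shows "f \<in> l2"
  unfolding l2_def using assms
  by (auto intro!: nonneg_bdd_above_summable_on bdd_aboveI[of _ C])

lemma l2inner_summable:
  assumes "f \<in> l2" "g \<in> l2"
  shows "(\<lambda>i. cinner (f i) (g i)) summable_on UNIV"
proof -
  have "(\<lambda>i. (nsq (f i) + nsq (g i)) * (1/2)) summable_on UNIV"
    using assms by (intro summable_on_cmult_left summable_on_add) (auto simp: l2_def)
  moreover have "norm (cinner (f i) (g i)) \<le> (nsq (f i) + nsq (g i)) * (1/2)" for i
    using cinner_bound[of 1 "f i" "g i"] by simp
  ultimately have "(\<lambda>i. norm (cinner (f i) (g i))) summable_on UNIV"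
    by (intro Infinite_Sum.abs_summable_on_comparison_test'[where g = "\<lambda>i. (nsq (f i) + nsq (g i)) * (1/2)"]) auto
  then show ?thesis by (rule abs_summable_summable)
qed

lemma l2_add: "f \<in> l2 \<Longrightarrow> g \<in> l2 \<Longrightarrow> f + g \<in> l2"
proof -
  assume fg: "f \<in> l2" "g \<in> l2"
  have "(\<lambda>i. 2 * nsq (f i) + 2 * nsq (g i)) summable_on UNIV"
    using fg by (intro summable_on_cmult_right summable_on_add) (auto simp: l2_def)
  then show ?thesis unfolding l2_def mem_Collect_eq
    by (rule summable_on_comparison_test) (use nsq_add_le in \<open>auto simp: plus_fun_def\<close>)
qed

lemma l2_sc: "f \<in> l2 \<Longrightarrow> l2sc a f \<in> l2"
  unfolding l2_def l2sc_def mem_Collect_eq nsq_scaleC by (rule summable_on_cmult_right)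

lemma l2_diff: "f \<in> l2 \<Longrightarrow> g \<in> l2 \<Longrightarrow> f - g \<in> l2"
proof -
  have "f - g = f + l2sc (-1) g" by (auto simp: l2sc_def scaleC_minus_one)
  then show "f \<in> l2 \<Longrightarrow> g \<in> l2 \<Longrightarrow> f - g \<in> l2" by (metis l2_add l2_sc)
qed

lemma l2inner_add_left:
  "f \<in> l2 \<Longrightarrow> g \<in> l2 \<Longrightarrow> h \<in> l2 \<Longrightarrow> l2inner (f + g) h = l2inner f h + l2inner g h"
  unfolding l2inner_def plus_fun_def cinner_add_left by (intro infsum_add l2inner_summable)

lemma l2inner_sc_left: "l2inner (l2sc a f) g = a * l2inner f g"
  unfolding l2inner_def l2sc_def cinner_scaleC_left by (rule infsum_cmult_right')

lemma l2inner_cnj: "l2inner g f = cnj (l2inner f g)"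
  unfolding l2inner_def by (subst cinner_conj) (rule infsum_cnj)

lemma l2inner_add_right:
  "f \<in> l2 \<Longrightarrow> g \<in> l2 \<Longrightarrow> h \<in> l2 \<Longrightarrow> l2inner h (f + g) = l2inner h f + l2inner h g"
  by (metis l2inner_add_left l2inner_cnj complex_cnj_add)

lemma l2inner_diff_left:
  "f \<in> l2 \<Longrightarrow> g \<in> l2 \<Longrightarrow> h \<in> l2 \<Longrightarrow> l2inner (f - g) h = l2inner f h - l2inner g h"
  using l2inner_add_left[of "f - g" g h] by (simp add: l2_diff)

lemma l2inner_diff_right:
  "f \<in> l2 \<Longrightarrow> g \<in> l2 \<Longrightarrow> h \<in> l2 \<Longrightarrow> l2inner h (f - g) = l2inner h f - l2inner h g"
  using l2inner_add_right[of "f - g" g h] by (simp add: l2_diff)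

lemma l2inner_sc_right: "l2inner f (l2sc a g) = cnj a * l2inner f g"
  by (metis l2inner_sc_left l2inner_cnj complex_cnj_mult)

abbreviation l2sq :: "('i \<Rightarrow> 'h::complex_hilbert) \<Rightarrow> real" where
  "l2sq f \<equiv> Re (l2inner f f)"

lemma l2inner_self: "l2inner f f = of_real (\<Sum>\<^sub>\<infinity>i. nsq (f i))"
proof (cases "(\<lambda>i. nsq (f i)) summable_on UNIV")
  case True
  then have "((\<lambda>i. complex_of_real (nsq (f i))) has_sum of_real (\<Sum>\<^sub>\<infinity>i. nsq (f i))) UNIV"
    unfolding has_sum_of_real_iff by (rule has_sum_infsum)
  then show ?thesis unfolding l2inner_def by (intro infsumI) (simp flip: cinner_self)
next
  \<comment> \<open>Without summability both infinite sums take the default value 0.\<close>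
  case False
  then have "\<not> (\<lambda>i. cinner (f i) (f i)) summable_on UNIV" using summable_on_Re by blast
  with False show ?thesis unfolding l2inner_def by (simp add: infsum_not_exists)
qed

lemma l2sq_eq: "l2sq f = (\<Sum>\<^sub>\<infinity>i. nsq (f i))"
  by (simp add: l2inner_self)

lemma l2sq_nonneg [simp]: "l2sq f \<ge> 0"
  unfolding l2sq_eq by (intro infsum_nonneg) auto

lemma sum_le_l2sq: "f \<in> l2 \<Longrightarrow> finite S \<Longrightarrow> (\<Sum>i\<in>S. nsq (f i)) \<le> l2sq f"
  unfolding l2sq_eq by (rule finite_sum_le_infsum) (auto simp: l2_def)

lemma l2sq_le:
  assumes "\<And>S. finite S \<Longrightarrow> (\<Sum>i\<in>S. nsq (f i)) \<le> C"
  shows "l2sq f \<le> C"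
  unfolding l2sq_eq using assms l2I[of f C]
  by (intro infsum_le_finite_sums) (auto simp: l2_def)

lemma l2sq_zero_iff: "f \<in> l2 \<Longrightarrow> l2sq f = 0 \<longleftrightarrow> f = 0"
proof
  assume "f \<in> l2" "l2sq f = 0"
  then have "nsq (f i) \<le> 0" for i using sum_le_l2sq[of f "{i}"] by simp
  then have "nsq (f i) = 0" for i using nsq_nonneg[of "f i"] by (intro antisym)
  then show "f = 0" by (auto simp: fun_eq_iff)
qed (simp add: l2inner_def)

lemma l2sq_add:
  "f \<in> l2 \<Longrightarrow> g \<in> l2 \<Longrightarrow> l2sq (f + g) = l2sq f + l2sq g + 2 * Re (l2inner f g)"
  using l2inner_cnj[of f g] by (simp add: l2inner_add_left l2inner_add_right l2_add)

lemma l2sq_sc: "l2sq (l2sc a f) = (cmod a)\<^sup>2 * l2sq f"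
proof -
  have "l2inner (l2sc a f) (l2sc a f) = (a * cnj a) * l2inner f f"
    by (simp add: l2inner_sc_left l2inner_sc_right)
  then show ?thesis by (simp add: complex_norm_square[symmetric] flip: of_real_power)
qed

lemma l2inner_le: "f \<in> l2 \<Longrightarrow> g \<in> l2 \<Longrightarrow> 2 * Re (l2inner f g) \<le> l2sq f + l2sq g"
proof -
  assume fg: "f \<in> l2" "g \<in> l2"
  have "l2sq (f - g) = l2sq f + l2sq g - 2 * Re (l2inner f g)"
    using l2inner_cnj[of f g] fg by (simp add: l2inner_diff_left l2inner_diff_right l2_diff)
  then show ?thesis using l2sq_nonneg[of "f - g"] by linarith
qed

text \<open>A left inverse \<open>S\<close> of \<open>U\<close> makes both contractions force \<open>U\<close> to be isometric and \<open>US\<close>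
  to be a contractive idempotent, hence self-adjoint.\<close>
lemma contraction_left_inverse_adjoint:
  fixes K :: "('i \<Rightarrow> 'h::complex_hilbert) set"
  assumes K: "K \<subseteq> l2" "\<And>f g. f \<in> K \<Longrightarrow> g \<in> K \<Longrightarrow> f + g \<in> K" "\<And>f a. f \<in> K \<Longrightarrow> l2sc a f \<in> K"
    and U: "lin_on K l2sc U" "\<And>f. f \<in> K \<Longrightarrow> l2sq (U f) \<le> l2sq f"
    and S: "lin_on K l2sc S" "\<And>f. f \<in> K \<Longrightarrow> l2sq (S f) \<le> l2sq f"
    and SU: "\<And>f. f \<in> K \<Longrightarrow> S (U f) = f"
  shows "isometry_on K l2sc l2inner U" "adjoint_on K l2inner U S"
proof -
  have Uin: "U f \<in> K" and Uadd: "g \<in> K \<Longrightarrow> U (f + g) = U f + U g"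
    and Usc: "U (l2sc a f) = l2sc a (U f)" if "f \<in> K" for f g a
    using U(1) that by (auto simp: lin_on_def)
  have Sin: "S f \<in> K" and Sadd: "g \<in> K \<Longrightarrow> S (f + g) = S f + S g"
    and Ssc: "S (l2sc a f) = l2sc a (S f)" if "f \<in> K" for f g a
    using S(1) that by (auto simp: lin_on_def)
  have l2: "f \<in> l2" if "f \<in> K" for f using K that by auto
  have diff: "f - g = f + l2sc (-1) g" for f g :: "'i \<Rightarrow> 'h" by (auto simp: l2sc_def scaleC_minus_one)
  have Kdiff: "f - g \<in> K" if "f \<in> K" "g \<in> K" for f g unfolding diff using K that by simp
  have Sdiff: "S (f - g) = S f - S g" if "f \<in> K" "g \<in> K" for f g
    unfolding diff using K that by (simp add: Sadd Ssc)
  \<comment> \<open>The identity \<open>f = S (U f)\<close> squeezes the norm of \<open>U f\<close>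
    between two copies of that of \<open>f\<close>.\<close>
  have norm: "l2sq (U f) = l2sq f" if "f \<in> K" for f
    using U(2)[OF that] S(2)[OF Uin[OF that]] SU[OF that] by simp
  show "isometry_on K l2sc l2inner U"
    using U(1) norm by (auto simp: isometry_on_def l2inner_self)
  have re: "Re (l2inner (U f) (U g)) = Re (l2inner f g)" if "f \<in> K" "g \<in> K" for f g
    using norm[of "f + g"] norm[of f] norm[of g] that K l2sq_add[of f g] l2sq_add[of "U f" "U g"]
    by (simp add: l2 Uin Uadd)
  have U_inner: "l2inner (U f) (U g) = l2inner f g" if "f \<in> K" "g \<in> K" for f g
  proof -
    have "Im (l2inner (U f) (U g)) = Im (l2inner f g)"
      using re[of "l2sc (- \<i>) f" g] that K by (simp add: Usc l2inner_sc_left)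
    with re[OF that] show ?thesis by (simp add: complex_eq_iff)
  qed
  show "adjoint_on K l2inner U S"
    unfolding adjoint_on_def
  proof (intro conjI ballI Sin)
    fix f g assume f: "f \<in> K" and g: "g \<in> K"
    define h where "h = g - U (S g)"
    have h: "h \<in> K" and Sh: "S h = 0"
      unfolding h_def using g by (simp_all add: Kdiff Uin Sin Sdiff SU)
    \<comment> \<open>\<open>U f\<close> has the least norm among the vectors
      \<open>U f + t h\<close>, because \<open>S\<close> sends them all to \<open>f\<close> without
      increasing norms.\<close>
    have "0 \<le> 2 * Re (cnj t * l2inner (U f) h) + (cmod t)\<^sup>2 * l2sq h" for t
    proof -
      have "S (U f + l2sc t h) = f"
        using f h K by (simp add: Sadd Ssc SU Uin Sh) (auto simp: l2sc_def)
      then have "l2sq f \<le> l2sq (U f + l2sc t h)"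
        using S(2)[of "U f + l2sc t h"] f h K by (simp add: Uin)
      also have "\<dots> = l2sq f + (cmod t)\<^sup>2 * l2sq h + 2 * Re (l2inner (U f) (l2sc t h))"
        using f h l2sq_add[of "U f" "l2sc t h"] by (simp add: l2 Uin l2_sc norm l2sq_sc)
      finally show ?thesis by (simp add: l2inner_sc_right)
    qed
    then have "l2inner (U f) h = 0" by (rule zero_if_quadratic_nonneg) simp
    then have "l2inner (U f) g = l2inner (U f) (U (S g))"
      unfolding h_def using f g by (simp add: l2inner_diff_right l2 Uin Sin)
    then show "l2inner (U f) g = l2inner f (S g)" using f g by (simp add: U_inner Sin)
  qed
qed

text \<open>Nondegeneracy of the inner product determines adjoints on \<open>K\<close>; off
  \<open>K\<close> the choice made by \<open>adj\<close> is arbitrary.\<close>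

lemma adj_eqI:
  assumes K: "K \<subseteq> l2" "\<And>f g. f \<in> K \<Longrightarrow> g \<in> K \<Longrightarrow> f - g \<in> K"
    and S: "adjoint_on K l2inner T S" and T: "\<And>k. k \<in> K \<Longrightarrow> T k \<in> K" and k: "k \<in> K"
  shows "adj K l2inner T k = S k"
proof -
  define S' where "S' = adj K l2inner T"
  have S': "adjoint_on K l2inner T S'"
    unfolding S'_def adj_def by (rule someI[of "adjoint_on K l2inner T", OF S])
  define d where "d = S' k - S k"
  have in_K: "S' k \<in> K" "S k \<in> K" and d: "d \<in> K"
    using S S' k K(2) by (auto simp: adjoint_on_def d_def)
  have "l2inner d (S' k) = l2inner d (S k)"
    using S S' d k by (simp add: adjoint_on_def)
  moreover have "l2inner d d = l2inner d (S' k) - l2inner d (S k)"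
    unfolding d_def using d in_K K(1) by (intro l2inner_diff_right) (auto simp: d_def)
  ultimately have "l2sq d = 0" by simp
  then have "d = 0" using l2sq_zero_iff d K(1) by blast
  then show ?thesis by (simp add: d_def S'_def)
qed

lemma lin_onD:
  assumes "lin_on C sc T" "x \<in> C"
  shows "T x \<in> C" "y \<in> C \<Longrightarrow> T (x + y) = T x + T y" "T (sc a x) = sc a (T x)"
  using assms by (auto simp: lin_on_def)

section \<open>Least common multiples and coherent functions\<close>

text \<open>\<open>s * a\<close> is a least common right multiple of \<open>s\<close> and
  \<open>p\<close>, recorded through its two cofactors; these are what enters the covariance
  relation \<open>W\<^sub>s\<^sup>* W\<^sub>p = W\<^sub>a W\<^sub>b\<^sup>*\<close>.\<close>

definition lcm_complement :: "'p::monoid_mult \<Rightarrow> 'p \<Rightarrow> 'p \<Rightarrow> 'p \<Rightarrow> bool" where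
  "lcm_complement s p a b \<longleftrightarrow> s * a = p * b \<and> (\<forall>c d. s * c = p * d \<longrightarrow> (\<exists>e. c = a * e \<and> d = b * e))"

lemma lcm_complementD: "lcm_complement s p a b \<Longrightarrow> s * a = p * b"
  by (simp add: lcm_complement_def)

lemma lcm_complementE:
  assumes "lcm_complement s p a b" "s * c = p * d"
  obtains e where "c = a * e" "d = b * e"
  using assms unfolding lcm_complement_def by blast

lemma lcm_complement_commute: "lcm_complement s p a b \<Longrightarrow> lcm_complement p s b a"
  unfolding lcm_complement_def by metis

lemma rideal_iff: "x \<in> rideal S s \<longleftrightarrow> (\<exists>c\<in>S. x = s * c)"
  by (auto simp: rideal_def)

text \<open>An index type with a surjection onto \<open>P\<close> replaces \<open>P\<close> itself,
  so that functions on lists can serve. An index whose value already occurs at an earlier index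
  contributes nothing, since its space \<open>L i\<close> below is zero.\<close>

locale nica_dilation =
  fixes P1 :: "'p::monoid_mult set"
    and V :: "'p \<Rightarrow> 'h::complex_hilbert \<Rightarrow> 'h"
    and \<pi> :: "'i \<Rightarrow> 'p"
    and lt :: "'i rel"
  assumes lcm: "right_LCM (UNIV :: 'p set)"
    and sub: "submonoid P1"
    and factor: "closed_under_factorization P1"
    and orth: "preserves_orthogonality P1"
    and nica: "nica_rep UNIV scaleC cinner P1 V"
    and surj: "surj \<pi>"
    and wf: "wf lt"
    and total: "i \<noteq> j \<Longrightarrow> (i, j) \<in> lt \<or> (j, i) \<in> lt"
begin

section \<open>Least common multiples relative to \<open>P1\<close>\<close>

lemma cancel: "p * x = p * y \<Longrightarrow> x = y" for p :: 'p
  using lcm unfolding right_LCM_def left_cancellative_def by blast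

lemma join_lcm_complement:
  assumes "rideal UNIV s \<inter> rideal UNIV p = rideal UNIV r"
  obtains a b :: 'p where "lcm_complement s p a b" "r = s * a"
proof -
  have "r * 1 \<in> rideal UNIV r" unfolding rideal_def by blast
  then have "r \<in> rideal UNIV s \<inter> rideal UNIV p" using assms by simp
  then obtain a b where ab: "r = s * a" "r = p * b" unfolding rideal_def by blast
  have "\<exists>e. c = a * e \<and> d = b * e" if cd: "s * c = p * d" for c d
  proof -
    have "s * c \<in> rideal UNIV s \<inter> rideal UNIV p"
      unfolding Int_iff rideal_iff using cd by blast
    then obtain e where e: "s * c = r * e" unfolding assms by (auto simp: rideal_def)
    have "c = a * e" by (rule cancel[of s]) (metis e ab(1) mult.assoc)
    moreover have "d = b * e" by (rule cancel[of p]) (metis e ab(2) cd mult.assoc)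
    ultimately show ?thesis by blast
  qed
  then have "lcm_complement s p a b" using ab by (auto simp: lcm_complement_def)
  then show thesis using ab that by blast
qed

lemma lcm_complement_exists:
  assumes "s * c = p * (d :: 'p)" obtains a b where "lcm_complement s p a b"
proof -
  have "s * c \<in> rideal UNIV s \<inter> rideal UNIV p"
    unfolding Int_iff rideal_iff using assms by blast
  then obtain r where "rideal UNIV s \<inter> rideal UNIV p = rideal UNIV r"
    using lcm unfolding right_LCM_def by blast
  then show thesis using join_lcm_complement that by metis
qed

lemma lcm_complement_join:
  assumes "lcm_complement s p a b" "s * a = r" shows "r \<in> join_in UNIV s p"
proof -
  have "x \<in> rideal UNIV r" if "x \<in> rideal UNIV s \<inter> rideal UNIV p" for x
  proof -
    obtain c d where cd: "x = s * c" "x = p * d" using \<open>x \<in> _\<close> by (metis IntE rideal_iff)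
    obtain e where "c = a * e" using lcm_complementE[OF assms(1), of c d] cd by metis
    then have "x = r * e" using cd(1) assms(2) by (metis mult.assoc)
    then show ?thesis unfolding rideal_iff by blast
  qed
  moreover have "x \<in> rideal UNIV s \<inter> rideal UNIV p" if "x \<in> rideal UNIV r" for x
    using that assms(2) lcm_complementD[OF assms(1)] unfolding Int_iff rideal_iff by (metis mult.assoc UNIV_I)
  ultimately show ?thesis unfolding join_in_def by blast
qed

lemma one_P1: "1 \<in> P1" and mult_P1: "a \<in> P1 \<Longrightarrow> b \<in> P1 \<Longrightarrow> a * b \<in> P1"
  using sub by (auto simp: submonoid_def)

lemma factor_left: "a * b \<in> P1 \<Longrightarrow> a \<in> P1" and factor_right: "a * b \<in> P1 \<Longrightarrow> b \<in> P1"
  using factor unfolding closed_under_factorization_def by blast+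

lemma lcm_complement_P1: "lcm_complement s p a b \<Longrightarrow> s * c = p * d \<Longrightarrow> c \<in> P1 \<Longrightarrow> a \<in> P1"
  by (metis lcm_complementE factor_left)

text \<open>Preservation of orthogonality turns a common multiple in the whole monoid into one with
  cofactors in \<open>P1\<close>; these are right multiples of \<open>c\<close> and
  \<open>d\<close>, and closure under factorization applies.\<close>

lemma lcm_complement_inside_P1:
  assumes "lcm_complement a b c d" "a \<in> P1" "b \<in> P1" shows "c \<in> P1" "d \<in> P1"
proof -
  have "a * c \<in> rideal UNIV a \<inter> rideal UNIV b"
    unfolding Int_iff rideal_iff using lcm_complementD[OF assms(1)] by blast
  then have "rideal P1 a \<inter> rideal P1 b \<noteq> {}"
    using orth assms unfolding preserves_orthogonality_def by blast
  then obtain c' d' where "c' \<in> P1" "d' \<in> P1" "a * c' = b * d'"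
    by (auto simp: rideal_def)
  then show "c \<in> P1" "d \<in> P1" using lcm_complementE[OF assms(1)] factor_left by metis+
qed

section \<open>The given representation and its adjoints\<close>

lemma V_one: "V 1 x = x"
  and V_mult: "p \<in> P1 \<Longrightarrow> q \<in> P1 \<Longrightarrow> V (p * q) x = V p (V q x)"
  and V_isometry: "p \<in> P1 \<Longrightarrow> isometry_on UNIV scaleC cinner (V p)"
  using nica by (auto simp: nica_rep_def)

lemma V_add: "p \<in> P1 \<Longrightarrow> V p (x + y) = V p x + V p y"
  and V_sc: "p \<in> P1 \<Longrightarrow> V p (scaleC t x) = scaleC t (V p x)"
  using V_isometry by (auto simp: isometry_on_def lin_on_def)

definition A :: "'p \<Rightarrow> 'h \<Rightarrow> 'h" where
  "A p = adj UNIV cinner (V p)"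

lemma A_adjoint: "p \<in> P1 \<Longrightarrow> cinner (V p x) y = cinner x (A p y)"
  using isometry_adjoint[OF V_isometry] by (simp add: adjoint_on_def A_def)

lemma A_adjoint': "p \<in> P1 \<Longrightarrow> cinner (A p x) y = cinner x (V p y)"
  using A_adjoint by (metis cinner_conj)

lemma V_inner: "p \<in> P1 \<Longrightarrow> cinner (V p x) (V p y) = cinner x y"
  by (rule isometry_cinner[OF V_isometry])

lemma V_zero: "p \<in> P1 \<Longrightarrow> V p 0 = 0"
  using V_add[of p 0 0] by simp

lemma A_V: "p \<in> P1 \<Longrightarrow> A p (V p x) = x"
  by (rule cinner_eqI) (simp add: V_inner flip: A_adjoint)

lemma A_add: "p \<in> P1 \<Longrightarrow> A p (x + y) = A p x + A p y"
  by (rule cinner_eqI) (simp add: cinner_add_right flip: A_adjoint)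

lemma A_sc: "p \<in> P1 \<Longrightarrow> A p (scaleC t x) = scaleC t (A p x)"
  by (rule cinner_eqI) (simp add: cinner_scaleC_right flip: A_adjoint)

lemma A_diff: "p \<in> P1 \<Longrightarrow> A p (x - y) = A p x - A p y"
  by (rule cinner_eqI) (simp add: cinner_diff_right flip: A_adjoint)

lemma A_zero: "p \<in> P1 \<Longrightarrow> A p 0 = 0"
  using A_add[of p 0 0] by simp

lemma A_one: "A 1 x = x"
  by (rule cinner_eqI) (simp add: one_P1 V_one flip: A_adjoint)

lemma A_mult: "p \<in> P1 \<Longrightarrow> q \<in> P1 \<Longrightarrow> A (p * q) x = A q (A p x)"
  by (rule cinner_eqI) (simp add: mult_P1 V_mult flip: A_adjoint)

lemma nsq_A_le: "p \<in> P1 \<Longrightarrow> nsq (A p x) \<le> nsq x"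
proof -
  assume p: "p \<in> P1"
  have "2 * cmod (cinner (V p (A p x)) x) \<le> nsq (V p (A p x)) + nsq x"
    using cinner_bound[of 1 "V p (A p x)" x] by simp
  moreover have "nsq (A p x) \<le> cmod (cinner (V p (A p x)) x)"
    using complex_Re_le_cmod by (simp add: A_adjoint p)
  ultimately show ?thesis by (simp add: V_inner p)
qed

text \<open>Nica covariance rewritten as
  \<open>V\<^sub>a\<^sup>* V\<^sub>b = V\<^sub>c V\<^sub>d\<^sup>*\<close>: a least common multiple
  in \<open>P\<close> of elements of \<open>P1\<close> is also one in \<open>P1\<close>, and the
  outer isometries are cancelled from the product of range projections.\<close>

lemma A_V_lcm_complement:
  assumes "lcm_complement a b c d" "a \<in> P1" "b \<in> P1"
  shows "A a (V b x) = V c (A d x)"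
proof -
  note cd = lcm_complement_inside_P1[OF assms]
  have "rideal P1 a \<inter> rideal P1 b = rideal P1 (a * c)"
  proof
    show "rideal P1 (a * c) \<subseteq> rideal P1 a \<inter> rideal P1 b"
      using lcm_complementD[OF assms(1)] cd unfolding subset_iff Int_iff rideal_iff by (metis mult.assoc mult_P1)
    show "rideal P1 a \<inter> rideal P1 b \<subseteq> rideal P1 (a * c)"
    proof
      fix y assume "y \<in> rideal P1 a \<inter> rideal P1 b"
      then obtain c' d' where y: "c' \<in> P1" "y = a * c'" "y = b * d'" by (metis IntE rideal_iff)
      then obtain e where "c' = c * e" using lcm_complementE[OF assms(1)] by metis
      then show "y \<in> rideal P1 (a * c)" using y factor_right unfolding rideal_iff by (metis mult.assoc)
    qed
  qed
  then have "a * c \<in> join_in P1 a b" using cd assms by (auto simp: join_in_def mult_P1)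
  then have *: "V a (A a (V b (A b z))) = V (a * c) (A (a * c) z)" for z
    using nica assms unfolding nica_rep_def A_def by blast
  have "A a (V b x) = A a (V a (A a (V b (A b (V b x)))))" by (simp add: A_V assms)
  also have "\<dots> = A a (V a (V c (A (b * d) (V b x))))"
    by (simp only: * V_mult[OF assms(2) cd(1)] lcm_complementD[OF assms(1), symmetric])
  also have "\<dots> = V c (A d x)" using cd assms by (simp add: A_mult A_V)
  finally show ?thesis .
qed

text \<open>Without a common multiple the two range projections are orthogonal, and the outer
  isometries cancel again.\<close>

lemma A_V_orth:
  assumes "a \<in> P1" "b \<in> P1" "\<And>c d. a * c \<noteq> b * d"
  shows "A a (V b x) = 0"
proof -
  have "join_in P1 a b = {}"
  proof (rule equals0I)
    fix r assume "r \<in> join_in P1 a b"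
    then have r: "rideal P1 a \<inter> rideal P1 b = rideal P1 r" by (simp add: join_in_def)
    have "r \<in> rideal P1 r" unfolding rideal_iff by (rule bexI[OF _ one_P1]) simp
    then obtain c d where "r = a * c" "r = b * d" unfolding r[symmetric] Int_iff rideal_iff by blast
    then show False using assms(3) by metis
  qed
  then have "V a (A a (V b (A b z))) = 0" for z
    using nica assms unfolding nica_rep_def A_def by blast
  then have "A a (V a (A a (V b (A b (V b x))))) = 0" by (simp add: A_zero assms)
  then show ?thesis by (simp add: A_V assms)
qed

section \<open>Coherent functions and the operators \<open>w p\<close>\<close>

definition coherent :: "('p \<Rightarrow> 'h) \<Rightarrow> bool" where
  "coherent F \<longleftrightarrow> (\<forall>s. \<forall>a\<in>P1. F (s * a) = A a (F s))"

lemma coherentD: "coherent F \<Longrightarrow> a \<in> P1 \<Longrightarrow> F (s * a) = A a (F s)"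
  by (simp add: coherent_def)

text \<open>If \<open>F s\<close> stands for the component in \<open>H\<close> of \<open>W\<^sub>s\<^sup>* k\<close>, then \<open>w p F\<close> represents \<open>W\<^sub>p k\<close>:
  by Nica covariance \<open>W\<^sub>s\<^sup>* W\<^sub>p = W\<^sub>a W\<^sub>b\<^sup>*\<close>, and compression to \<open>H\<close> turns \<open>W\<^sub>a\<close> into \<open>V\<^sub>a\<close> or \<open>0\<close>.\<close>
definition w :: "'p \<Rightarrow> ('p \<Rightarrow> 'h) \<Rightarrow> 'p \<Rightarrow> 'h" where
  "w p F s = (if \<exists>a b. lcm_complement s p a b \<and> a \<in> P1
     then let (a, b) = SOME (a, b). lcm_complement s p a b \<and> a \<in> P1 in V a (F b) else 0)"

text \<open>The chosen cofactors depend only on \<open>s\<close> and \<open>p\<close>, so one case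
  split covers all functions \<open>F\<close> at once; this gives linearity of
  \<open>w p\<close>.\<close>

lemma w_form:
  obtains "\<And>a b. a \<in> P1 \<Longrightarrow> \<not> lcm_complement s p a b" "\<And>F. w p F s = 0"
  | a b where "lcm_complement s p a b" "a \<in> P1" "\<And>F. w p F s = V a (F b)"
proof (cases "\<exists>a b. lcm_complement s p a b \<and> a \<in> P1")
  case True
  obtain a b where ab: "(SOME (a, b). lcm_complement s p a b \<and> a \<in> P1) = (a, b)" by fastforce
  have "case (SOME (a, b). lcm_complement s p a b \<and> a \<in> P1) of (a, b) \<Rightarrow> lcm_complement s p a b \<and> a \<in> P1"
    by (rule someI_ex) (use True in auto)
  then have "lcm_complement s p a b" "a \<in> P1" by (simp_all add: ab)
  moreover have "w p F s = V a (F b)" for F unfolding w_def if_P[OF True] ab by simp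
  ultimately show thesis using that(2) by blast
next
  case False
  then have "w p F s = 0" for F unfolding w_def by (rule if_not_P)
  with False show thesis by (intro that(1)) blast+
qed

lemma w_add: "w p (F + G) = w p F + w p G"
proof
  show "w p (F + G) s = (w p F + w p G) s" for s
    by (cases rule: w_form[of s p]) (simp_all add: V_add)
qed

lemma w_sc: "w p (l2sc t F) = l2sc t (w p F)"
proof
  show "w p (l2sc t F) s = l2sc t (w p F) s" for s
    by (cases rule: w_form[of s p]) (simp_all add: V_sc l2sc_def)
qed

lemma w_eq_0: "(\<And>a b. a \<in> P1 \<Longrightarrow> s * a \<noteq> p * b) \<Longrightarrow> w p F s = 0"
  by (cases rule: w_form[of s p]) (simp, metis lcm_complementD)

text \<open>Two pairs of cofactors differ by an invertible \<open>u\<close> in \<open>P1\<close>,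
  for which \<open>V u\<close> is unitary; coherence of \<open>F\<close> then makes the two values
  agree.\<close>

lemma w_eq:
  assumes F: "coherent F" and ab: "lcm_complement s p a b" "a \<in> P1"
  shows "w p F s = V a (F b)"
proof (cases rule: w_form[of s p])
  case 1
  with ab show ?thesis by blast
next
  case (2 c d)
  note cd' = 2(1,2)
  obtain u where u: "c = a * u" "d = b * u" using lcm_complementE[OF ab(1) lcm_complementD[OF cd'(1)]] .
  obtain v where v: "a = c * v" using lcm_complementE[OF cd'(1) lcm_complementD[OF ab(1)]] .
  have uv: "u * v = 1" by (rule cancel[of a]) (metis u(1) v mult.assoc mult_1_right)
  have u1: "u \<in> P1" "v \<in> P1" using u(1) v ab(2) cd'(2) factor_right by metis+
  have "V u (A u x) = x" for x
  proof -
    have "V u (V v x) = x" for x using V_mult[OF u1, of x] by (simp add: uv V_one)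
    then show ?thesis by (metis A_V u1(1))
  qed
  then have "V c (F d) = V a (F b)"
    using u u1 ab(2) by (simp add: V_mult coherentD[OF F])
  then show ?thesis by (simp add: 2(3))
qed

lemma w_cases:
  obtains a b where "lcm_complement s p a b" "a \<in> P1"
  | "\<And>a b. a \<in> P1 \<Longrightarrow> s * a \<noteq> p * b"
proof (cases "\<exists>c\<in>P1. \<exists>d. s * c = p * d")
  case True
  then obtain c d where cd: "c \<in> P1" "s * c = p * d" by blast
  obtain a b where ab: "lcm_complement s p a b" by (rule lcm_complement_exists[OF cd(2)])
  then show thesis using lcm_complement_P1[OF ab cd(2,1)] by (rule that(1))
qed (use that(2) in blast)

text \<open>Least common multiples can be formed in two stages, like the pasting of pullback
  squares.\<close>

lemma lcm_complement_trans:
  assumes "lcm_complement s p a' b'" "lcm_complement a a' u v" shows "lcm_complement (s * a) p u (b' * v)"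
  unfolding lcm_complement_def
proof (intro conjI allI impI)
  have "s * a * u = s * a' * v" using lcm_complementD[OF assms(2)] by (simp add: mult.assoc)
  then show "s * a * u = p * (b' * v)" using lcm_complementD[OF assms(1)] by (simp add: mult.assoc)
  fix c d assume cd: "s * a * c = p * d"
  then have "s * (a * c) = p * d" by (simp add: mult.assoc)
  then obtain e where e: "a * c = a' * e" "d = b' * e" by (rule lcm_complementE[OF assms(1)])
  obtain e' where "c = u * e'" "e = v * e'" using lcm_complementE[OF assms(2) e(1)] .
  then show "\<exists>e. c = u * e \<and> d = b' * v * e" using e by (auto simp: mult.assoc)
qed

lemma lcm_complement_shift: "lcm_complement (p * s) (p * q) a b \<longleftrightarrow> lcm_complement s q a (b :: 'p)"
proof -
  have "p * s * x = p * q * y \<longleftrightarrow> s * x = q * y" for x y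
    using cancel[of p "s * x" "q * y"] by (auto simp: mult.assoc)
  then show ?thesis by (simp add: lcm_complement_def)
qed

text \<open>The cofactors of \<open>s * a\<close> and \<open>p\<close> arise from those of
  \<open>s\<close> and \<open>p\<close> by pasting, and covariance of \<open>V\<close> moves
  \<open>A a\<close> past \<open>V a'\<close>. Where \<open>a\<close> and \<open>a'\<close> have no
  common multiple, both sides vanish.\<close>

lemma w_coherent:
  assumes F: "coherent F" shows "coherent (w p F)"
  unfolding coherent_def
proof (intro allI ballI)
  fix s a assume a: "a \<in> P1"
  show "w p F (s * a) = A a (w p F s)"
  proof (cases rule: w_cases[of s p])
    case (1 a' b')
    show ?thesis
    proof (cases "\<exists>c d. a * c = a' * d")
      case True
      then obtain u v where uv: "lcm_complement a a' u v" by (metis lcm_complement_exists)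
      then have uv': "u \<in> P1" "v \<in> P1" using lcm_complement_inside_P1 a 1 by blast+
      have "w p F (s * a) = V u (F (b' * v))" by (rule w_eq[OF F lcm_complement_trans[OF 1(1) uv] uv'(1)])
      also have "\<dots> = A a (V a' (F b'))" by (simp add: coherentD[OF F] uv' A_V_lcm_complement[OF uv a 1(2)])
      also have "\<dots> = A a (w p F s)" by (simp add: w_eq[OF F 1])
      finally show ?thesis .
    next
      case False
      have "w p F (s * a) = 0"
      proof (rule w_eq_0)
        fix c d assume "c \<in> P1"
        show "s * a * c \<noteq> p * d"
          using lcm_complementE[OF 1(1), of "a * c" d] False by (metis mult.assoc)
      qed
      moreover have "A a (V a' (F b')) = 0" using False by (intro A_V_orth a 1(2)) auto
      ultimately show ?thesis by (simp add: w_eq[OF F 1])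
    qed
  next
    case 2
    have "w p F (s * a) = 0" using 2 a by (intro w_eq_0) (auto simp: mult.assoc mult_P1)
    moreover have "w p F s = 0" using 2 by (intro w_eq_0) auto
    ultimately show ?thesis using a by (simp add: A_zero)
  qed
qed

text \<open>By left cancellation \<open>p * s\<close> and \<open>p * q\<close> have the same
  cofactors as \<open>s\<close> and \<open>q\<close>.\<close>

lemma w_shift: "coherent F \<Longrightarrow> w (p * q) F (p * s) = w q F s"
proof (cases rule: w_cases[of s q])
  case (1 a b)
  then show "coherent F \<Longrightarrow> ?thesis" using w_eq[of F "p * s" "p * q" a b] by (simp add: w_eq lcm_complement_shift)
next
  case 2
  have "p * s * a \<noteq> p * q * b" if "a \<in> P1" for a b
    using cancel[of p "s * a" "q * b"] 2[OF that] by (auto simp: mult.assoc)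
  then show ?thesis using 2 by (simp add: w_eq_0)
qed

lemma lcm_complement_multiple: "lcm_complement (p * s) p 1 (s :: 'p)"
proof -
  have "d = s * c" if "p * s * c = p * d" for c d
    by (rule cancel[of p]) (simp add: that mult.assoc[symmetric])
  then show ?thesis by (auto simp: lcm_complement_def)
qed

text \<open>This is \<open>W\<^sub>p\<^sup>* W\<^sub>p = 1\<close>: the shift is a left inverse of
  \<open>w p\<close>.\<close>

lemma w_of_multiple: "coherent F \<Longrightarrow> w p F (p * s) = F s"
  using w_eq[OF _ lcm_complement_multiple one_P1] by (simp add: V_one)

lemma w_one: "coherent F \<Longrightarrow> w 1 F = F"
  using w_of_multiple[of F 1] by auto

text \<open>The image of \<open>h\<close> in the dilation space: the compression of
  \<open>W\<^sub>s\<^sup>*\<close> to \<open>H\<close> has to be \<open>V\<^sub>s\<^sup>*\<close> on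
  \<open>P1\<close> and 0 elsewhere.\<close>

definition \<phi> :: "'h \<Rightarrow> 'p \<Rightarrow> 'h" where
  "\<phi> h s = (if s \<in> P1 then A s h else 0)"

lemma phi_coherent: "coherent (\<phi> h)"
  unfolding coherent_def \<phi>_def by (auto simp: A_mult A_zero mult_P1 dest: factor_left)

lemma phi_add: "\<phi> (h + g) = \<phi> h + \<phi> g"
  by (auto simp: \<phi>_def fun_eq_iff A_add)

lemma phi_sc: "\<phi> (scaleC t h) = l2sc t (\<phi> h)"
  by (auto simp: \<phi>_def fun_eq_iff A_sc l2sc_def)

lemma phi_one: "\<phi> h 1 = h"
  by (simp add: \<phi>_def one_P1 A_one)

section \<open>The vectors \<open>W\<^sub>q h\<close> and their matrix coefficients\<close>

abbreviation \<Phi> :: "'p \<Rightarrow> 'h \<Rightarrow> 'p \<Rightarrow> 'h" where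
  "\<Phi> q h \<equiv> w q (\<phi> h)"

lemma Phi_coherent: "coherent (\<Phi> q h)"
  by (rule w_coherent[OF phi_coherent])

lemma Phi_eq: "lcm_complement s q a b \<Longrightarrow> a \<in> P1 \<Longrightarrow> b \<in> P1 \<Longrightarrow> \<Phi> q h s = V a (A b h)"
  by (simp add: w_eq[OF phi_coherent] \<phi>_def)

lemma Phi_eq_0: "(\<And>a b. a \<in> P1 \<Longrightarrow> b \<in> P1 \<Longrightarrow> s * a \<noteq> q * b) \<Longrightarrow> \<Phi> q h s = 0"
  by (rule w_cases[of s q]) (auto simp: w_eq[OF phi_coherent] \<phi>_def V_zero w_eq_0 dest: lcm_complementD)

lemma Phi_cases:
  obtains a b where "lcm_complement s q a b" "a \<in> P1" "b \<in> P1"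
  | "\<And>a b. a \<in> P1 \<Longrightarrow> b \<in> P1 \<Longrightarrow> s * a \<noteq> q * b"
proof (cases "\<exists>c\<in>P1. \<exists>d\<in>P1. s * c = q * d")
  case True
  then obtain c d where cd: "c \<in> P1" "d \<in> P1" "s * c = q * d" by blast
  obtain a b where ab: "lcm_complement s q a b" by (rule lcm_complement_exists[OF cd(3)])
  then show thesis
    using lcm_complement_P1[OF ab cd(3,1)] lcm_complement_P1[OF lcm_complement_commute[OF ab] cd(3)[symmetric] cd(2)]
    by (rule that(1))
qed (use that(2) in blast)

text \<open>The identity \<open>W\<^sub>p\<^sup>* W\<^sub>s h = W\<^sub>b V\<^sub>a\<^sup>* h\<close>.\<close>
lemma Phi_shift:
  assumes "lcm_complement s p a b" "a \<in> P1"
  shows "\<Phi> s h (p * t) = \<Phi> b (A a h) t"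
proof -
  show ?thesis
  proof (cases rule: Phi_cases[of t b])
    case (1 u v)
    have "lcm_complement (p * t) s u (a * v)"
      using 1(1) lcm_complement_commute[OF assms(1)] lcm_complement_trans by blast
    then show ?thesis using 1 assms(2) by (simp add: Phi_eq[of _ _ u] mult_P1 A_mult)
  next
    case 2
    have "\<Phi> s h (p * t) = 0"
    proof (rule Phi_eq_0)
      fix u v assume uv: "u \<in> P1" "v \<in> P1"
      show "p * t * u \<noteq> s * v"
      proof
        assume "p * t * u = s * v"
        then have "s * v = p * (t * u)" by (simp add: mult.assoc)
        then obtain e where "v = a * e" "t * u = b * e" by (rule lcm_complementE[OF assms(1)])
        then show False using 2 uv factor_right by metis
      qed
    qed
    then show ?thesis using 2 by (simp add: Phi_eq_0)
  qed
qed

lemma Phi_shift_0: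
  assumes "\<And>a b. a \<in> P1 \<Longrightarrow> s * a \<noteq> p * b"
  shows "\<Phi> s h (p * t) = 0"
  by (rule Phi_eq_0) (metis assms mult.assoc)

text \<open>Coherence evaluates \<open>F (p * b) = F (s * a)\<close> as \<open>A a (F s)\<close>, so
  at \<open>s\<close> the operator \<open>W\<^sub>p W\<^sub>p\<^sup>*\<close> becomes the range
  projection of \<open>V a\<close>.\<close>

lemma w_shift_pointwise:
  assumes F: "coherent F" and ab: "lcm_complement s p a b" "a \<in> P1"
  shows "w p (\<lambda>t. F (p * t)) s = V a (A a (F s))"
proof -
  have "coherent (\<lambda>t. F (p * t))" using F by (auto simp: coherent_def simp flip: mult.assoc)
  then have "w p (\<lambda>t. F (p * t)) s = V a (F (s * a))"
    using w_eq[OF _ ab] lcm_complementD[OF ab(1)] by simp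
  then show ?thesis using coherentD[OF F ab(2)] by simp
qed

text \<open>At \<open>s\<close> in \<open>P1\<close> this is the covariance relation for
  \<open>V\<close>, and elsewhere both sides vanish. It makes \<open>H\<close> invariant under
  \<open>W p\<close> for \<open>p\<close> in \<open>P1\<close>.\<close>

lemma w_phi: "p \<in> P1 \<Longrightarrow> \<Phi> p h = \<phi> (V p h)"
proof
  fix s assume p: "p \<in> P1"
  show "\<Phi> p h s = \<phi> (V p h) s"
  proof (cases rule: Phi_cases[of s p])
    case (1 a b)
    then have "s \<in> P1" using p lcm_complementD mult_P1 factor_left by metis
    then show ?thesis using 1 p by (simp add: Phi_eq \<phi>_def A_V_lcm_complement)
  next
    case 2
    have "A s (V p h) = 0" if s: "s \<in> P1"
    proof (rule A_V_orth[OF s p])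
      show "s * c \<noteq> p * d" for c d
        using 2 lcm_complement_exists lcm_complement_inside_P1 lcm_complementD s p by metis
    qed
    with 2 show ?thesis by (simp add: Phi_eq_0 \<phi>_def)
  qed
qed

section \<open>The dilation space\<close>

text \<open>In the dilation, \<open>W\<^bsub>\<pi> i\<^esub> ` L i\<close> is the part of \<open>W\<^bsub>\<pi> i\<^esub> ` H\<close> orthogonal to
  \<open>W\<^bsub>\<pi> j\<^esub> ` H\<close> for all \<open>j\<close> below \<open>i\<close>.\<close>
definition L :: "'i \<Rightarrow> 'h set" where
  "L i = {h. \<forall>j a b. (j, i) \<in> lt \<longrightarrow> a \<in> P1 \<longrightarrow> b \<in> P1 \<longrightarrow> \<pi> i * a = \<pi> j * b \<longrightarrow> A a h = 0}"

lemma A_limit_zero: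
  assumes a: "a \<in> P1" and X: "\<And>n. A a (X n) = 0" and lim: "(\<lambda>n. nsq (X n - h)) \<longlonglongrightarrow> 0"
  shows "A a h = 0"
proof -
  have "(\<lambda>n. nsq (A a (X n) - 0)) \<longlonglongrightarrow> 0" by (simp add: X)
  moreover have "(\<lambda>n. nsq (A a (X n) - A a h)) \<longlonglongrightarrow> 0"
    by (rule tendsto_sandwich[OF _ _ tendsto_const lim])
       (auto simp: nsq_A_le a simp flip: A_diff)
  ultimately show ?thesis using nsq_limit_unique[of "\<lambda>n. A a (X n)" 0 "A a h"] by simp
qed

lemma closed_subspace_L: "closed_subspace (L i)"
  unfolding closed_subspace_def
proof (intro conjI ballI allI impI)
  fix X h assume X: "\<forall>n. X n \<in> L i" and lim: "(\<lambda>n. nsq (X n - h)) \<longlonglongrightarrow> 0"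
  show "h \<in> L i"
    unfolding L_def
  proof (intro CollectI allI impI)
    fix j a b assume *: "(j, i) \<in> lt" "a \<in> P1" "b \<in> P1" "\<pi> i * a = \<pi> j * b"
    have "A a (X n) = 0" for n using X * unfolding L_def by blast
    then show "A a h = 0" by (rule A_limit_zero[OF *(2) _ lim])
  qed
qed (auto simp: L_def A_zero A_add A_sc)

text \<open>The coordinates of \<open>F\<close> along the orthogonal pieces, the piece for
  \<open>i\<close> being identified with \<open>L i\<close>; here \<open>F (\<pi> i)\<close> is the
  component in \<open>H\<close> of \<open>W\<^sub>s\<^sup>* F\<close> for
  \<open>s = \<pi> i\<close>.\<close>

definition Psi :: "('p \<Rightarrow> 'h) \<Rightarrow> 'i \<Rightarrow> 'h" where
  "Psi F i = proj (L i) (F (\<pi> i))"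

lemma Psi_add: "Psi (F + G) = Psi F + Psi G"
  by (simp add: Psi_def fun_eq_iff proj_add closed_subspace_L)

lemma Psi_diff: "Psi (F - G) = Psi F - Psi G"
  by (simp add: Psi_def fun_eq_iff proj_diff closed_subspace_L)

lemma Psi_sc: "Psi (l2sc t F) = l2sc t (Psi F)"
  by (simp add: Psi_def fun_eq_iff proj_scaleC closed_subspace_L l2sc_def)

lemma Psi_zero: "Psi 0 = 0"
  by (simp add: Psi_def fun_eq_iff proj_zero closed_subspace_L)

lemma Psi_in_L: "Psi F i \<in> L i"
  by (simp add: Psi_def proj_in closed_subspace_L)

lemma cinner_Psi: "x \<in> L i \<Longrightarrow> cinner x (Psi F i) = cinner x (F (\<pi> i))"
  by (simp add: Psi_def cinner_proj_left closed_subspace_L)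

text \<open>Induction along \<open>lt\<close>: once \<open>F\<close> vanishes at all earlier
  indices, coherence puts \<open>F (\<pi> i)\<close> into \<open>L i\<close>, where it equals its
  own coordinate.\<close>

lemma Psi_eq_0D:
  assumes F: "coherent F" and "Psi F = 0" shows "F = 0"
proof
  have "F (\<pi> i) = 0" for i
    using wf
  proof (induction i)
    case (less i)
    have "A a (F (\<pi> i)) = 0" if *: "(j, i) \<in> lt" "a \<in> P1" "b \<in> P1" "\<pi> i * a = \<pi> j * b" for j a b
    proof -
      have "A a (F (\<pi> i)) = F (\<pi> i * a)" by (rule coherentD[OF F *(2), symmetric])
      also have "\<dots> = A b (F (\<pi> j))" unfolding *(4) by (rule coherentD[OF F *(3)])
      finally show ?thesis using less * by (simp add: A_zero)
    qed
    then have "F (\<pi> i) \<in> L i" unfolding L_def by blast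
    then have "F (\<pi> i) = Psi F i" by (simp add: Psi_def proj_id closed_subspace_L)
    then show ?case by (simp add: assms)
  qed
  then show "F s = 0 s" for s using surjD[OF surj, of s] by auto
qed

lemma VA_selfadjoint: "a \<in> P1 \<Longrightarrow> cinner (V a (A a x)) y = cinner x (V a (A a y))"
  by (simp add: A_adjoint A_adjoint')

text \<open>\<open>L i\<close> is cut out by kernels of operators \<open>A c\<close>. The range
  projections of \<open>V c\<close> and \<open>V a\<close> commute, so applying the latter preserves
  each of these kernels.\<close>

lemma VA_in_L:
  assumes x: "x \<in> L i" and a: "a \<in> P1" shows "V a (A a x) \<in> L i"
  unfolding L_def
proof (intro CollectI allI impI)
  fix j c d assume *: "(j, i) \<in> lt" "c \<in> P1" "d \<in> P1" "\<pi> i * c = \<pi> j * d"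
  then have x0: "A c x = 0" using x unfolding L_def by blast
  show "A c (V a (A a x)) = 0"
  proof (cases "\<exists>u v. c * u = a * v")
    case True
    then obtain u v where uv: "lcm_complement c a u v" by (metis lcm_complement_exists)
    have uv': "u \<in> P1" "v \<in> P1" using lcm_complement_inside_P1[OF uv *(2) a] .
    have "A c (V a (A a x)) = V u (A (a * v) x)"
      by (simp add: A_V_lcm_complement[OF uv *(2) a] A_mult a uv')
    also have "\<dots> = V u (A u (A c x))"
      using A_mult[OF *(2) uv'(1)] lcm_complementD[OF uv] by simp
    finally show ?thesis by (simp add: x0 A_zero V_zero uv')
  next
    case False
    then show ?thesis using A_V_orth[OF *(2) a] by blast
  qed
qed

text \<open>A self-adjoint operator leaving a closed subspace invariant commutes with the projection
  onto it.\<close>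

lemma proj_VA:
  assumes a: "a \<in> P1" shows "proj (L i) (V a (A a x)) = V a (A a (proj (L i) x))"
proof (rule proj_eqI[OF closed_subspace_L])
  show "V a (A a (proj (L i) x)) \<in> L i" by (intro VA_in_L a proj_in closed_subspace_L)
  fix m assume m: "m \<in> L i"
  have "cinner m (V a (A a x)) = cinner m (V a (A a (proj (L i) x)))"
    using VA_in_L[OF m a]
    by (simp add: VA_selfadjoint[OF a, symmetric] cinner_proj_left closed_subspace_L)
  then show "cinner m (V a (A a x) - V a (A a (proj (L i) x))) = 0" by (simp add: cinner_diff_right)
qed

text \<open>The range of \<open>V a\<close> is orthogonal to the kernel of \<open>A a\<close>, which
  contains \<open>L i\<close>.\<close>

lemma proj_L_V:
  assumes "(j, i) \<in> lt" "a \<in> P1" "b \<in> P1" "\<pi> i * a = \<pi> j * b"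
  shows "proj (L i) (V a x) = 0"
proof (rule proj_eqI[OF closed_subspace_L])
  fix m assume "m \<in> L i"
  then have "A a m = 0" using assms unfolding L_def by blast
  then show "cinner m (V a x - 0) = 0" using assms by (simp flip: A_adjoint')
qed (simp add: closed_subspaceD closed_subspace_L)

lemma Phi_add: "\<Phi> q (h + g) = \<Phi> q h + \<Phi> q g"
  by (simp add: phi_add w_add)

lemma Phi_sc: "\<Phi> q (scaleC t h) = l2sc t (\<Phi> q h)"
  by (simp add: phi_sc w_sc)

lemma Phi_zero: "\<Phi> q 0 = 0"
  using Phi_add[of q 0 0] by simp

lemma Phi_self: "\<Phi> q h q = h"
  using w_of_multiple[OF phi_coherent, of q h 1] by (simp add: phi_one)

text \<open>Exchanging \<open>s\<close> and \<open>q\<close> swaps the cofactors, and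
  \<open>V\<^sub>a V\<^sub>b\<^sup>*\<close> has adjoint
  \<open>V\<^sub>b V\<^sub>a\<^sup>*\<close>.\<close>

lemma Phi_symmetric: "cinner (\<Phi> q h s) y = cinner h (\<Phi> s y q)"
proof (cases rule: Phi_cases[of s q])
  case (1 a b)
  then show ?thesis using lcm_complement_commute[OF 1(1)] by (simp add: Phi_eq A_adjoint A_adjoint')
next
  case 2
  then have "\<Phi> s y q = 0" by (intro Phi_eq_0) metis
  with 2 show ?thesis by (simp add: Phi_eq_0)
qed

text \<open>Different pieces stay orthogonal when a vector of one of them is first projected onto
  \<open>W\<^sub>q H\<close>. A nonzero value would come from a common multiple of
  \<open>\<pi> i\<close> and \<open>\<pi> j\<close> with cofactors in \<open>P1\<close>; if
  \<open>j\<close> is the smaller index it is killed by \<open>proj_L_V\<close>, otherwise by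
  \<open>x \<in> L j\<close>.\<close>

lemma proj_L_Phi_Phi:
  assumes x: "x \<in> L j" and "i \<noteq> j"
  shows "proj (L i) (\<Phi> q (\<Phi> (\<pi> j) x q) (\<pi> i)) = 0"
proof (cases rule: Phi_cases[of q "\<pi> j"])
  case (1 b' a')
  show ?thesis
  proof (cases rule: Phi_cases[of "\<pi> i" q])
    case ab: (1 a b)
    have eq: "\<Phi> q (\<Phi> (\<pi> j) x q) (\<pi> i) = V a (A b (V b' (A a' x)))"
      using 1 ab by (simp add: Phi_eq)
    show ?thesis
    proof (cases "\<exists>c d. b * c = b' * d")
      case True
      then obtain c d where cd: "lcm_complement b b' c d" by (metis lcm_complement_exists)
      note cd' = lcm_complement_inside_P1[OF cd ab(3) 1(2)]
      have eq': "V a (A b (V b' (A a' x))) = V (a * c) (A (a' * d) x)"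
        using 1 ab cd' by (simp add: A_V_lcm_complement[OF cd] V_mult A_mult)
      have m: "\<pi> i * (a * c) = \<pi> j * (a' * d)"
        using lcm_complementD[OF ab(1)] lcm_complementD[OF 1(1)] lcm_complementD[OF cd] by (metis mult.assoc)
      have P: "a * c \<in> P1" "a' * d \<in> P1" using 1 ab cd' by (simp_all add: mult_P1)
      consider "(j, i) \<in> lt" | "(i, j) \<in> lt" using total assms(2) by blast
      then have "proj (L i) (V (a * c) (A (a' * d) x)) = 0"
      proof cases
        case 1
        then show ?thesis by (rule proj_L_V[OF _ P m])
      next
        case 2
        then have "A (a' * d) x = 0" using x P m[symmetric] unfolding L_def by blast
        then show ?thesis by (simp add: V_zero P proj_zero closed_subspace_L)
      qed
      then show ?thesis by (simp add: eq eq')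
    next
      case False
      then have "A b (V b' (A a' x)) = 0" using ab 1 by (intro A_V_orth) auto
      then show ?thesis using ab by (simp add: eq V_zero proj_zero closed_subspace_L)
    qed
  next
    case 2
    then show ?thesis by (simp add: Phi_eq_0 proj_zero closed_subspace_L)
  qed
next
  case 2
  then have "\<Phi> (\<pi> j) x q = 0" by (rule Phi_eq_0)
  then show ?thesis by (simp add: Phi_zero proj_zero closed_subspace_L)
qed

text \<open>For \<open>q = \<pi> j\<close> the intermediate projection in the preceding lemma is
  trivial.\<close>

lemma Psi_Phi_delta: "x \<in> L j \<Longrightarrow> Psi (\<Phi> (\<pi> j) x) i = (if i = j then x else 0)"
  using proj_L_Phi_Phi[of x j i "\<pi> j"] by (auto simp: Psi_def Phi_self proj_id closed_subspace_L)

text \<open>The operators \<open>R i\<close> below are the projections onto the pieces, compressed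
  to \<open>W\<^sub>q H\<close> and transported to \<open>H\<close>. They are again mutually
  orthogonal projections and jointly injective, so Parseval's identity in \<open>H\<close> yields
  the sum.\<close>

lemma reproducing_has_sum:
  assumes F: "coherent F"
  shows "((\<lambda>i. cinner (Psi (\<Phi> q h) i) (Psi F i)) has_sum cinner h (F q)) UNIV"
proof -
  define T where "T i h = Psi (\<Phi> q h) i" for i h
  define R where "R i h = \<Phi> (\<pi> i) (T i h) q" for i h
  have TL: "T i h \<in> L i" for i h by (simp add: T_def Psi_in_L)
  have R_inner: "cinner (R i h) g = cinner (T i h) (\<Phi> q g (\<pi> i))" for i h g
    by (simp add: R_def Phi_symmetric)
  have TT: "cinner (R i h) g = cinner (T i h) (T i g)" for i h g
    unfolding R_inner using cinner_Psi[OF TL] by (simp add: T_def)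
  have T_R: "T i (R i h) = T i h" and VA: "a \<in> P1 \<Longrightarrow> b \<in> P1 \<Longrightarrow> lcm_complement (\<pi> i) q a b \<Longrightarrow> V a (A a (T i h)) = T i h"
    for i h a b
  proof -
    \<comment> \<open>\<open>\<Phi> q h (\<pi> i)\<close> lies in the range of \<open>V a\<close>,
      and the range projection passes through \<open>proj (L i)\<close>.\<close>
    show VA: "V a (A a (T i h)) = T i h" if "a \<in> P1" "b \<in> P1" "lcm_complement (\<pi> i) q a b" for a b
      using that by (simp add: T_def Psi_def Phi_eq A_V flip: proj_VA)
    show "T i (R i h) = T i h"
    proof (cases rule: Phi_cases[of "\<pi> i" q])
      case (1 a b)
      have "\<Phi> q (R i h) (\<pi> i) = V a (A a (T i h))"
        using 1 lcm_complement_commute[OF 1(1)] by (simp add: R_def Phi_eq A_V)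
      also have "\<dots> = T i h" using VA 1 by blast
      finally show ?thesis unfolding T_def[of i "R i h"] Psi_def
        by (simp add: proj_id closed_subspace_L TL)
    next
      case 2
      then show ?thesis by (simp add: T_def Psi_def Phi_eq_0 proj_zero closed_subspace_L)
    qed
  qed
  have "((\<lambda>i. cinner (R i h) (F q)) has_sum cinner h (F q)) UNIV"
  proof (rule orthogonal_projections_parseval)
    fix i j x y t
    show "R i (x + y) = R i x + R i y"
      by (simp add: R_def T_def Phi_add Psi_add)
    show "R i (scaleC t x) = scaleC t (R i x)"
      by (simp add: R_def T_def Phi_sc Psi_sc) (simp add: l2sc_def Phi_sc)
    show "cinner (R i x) y = cinner x (R i y)"
      using TT[of i x y] TT[of i y x] by (metis cinner_conj)
    show "R i (R i x) = R i x" unfolding R_def[of i "R i x"] T_R by (simp add: R_def)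
    show "R i (R j x) = 0" if "i \<noteq> j"
    proof -
      have "T i (R j x) = 0"
        unfolding T_def[of i] Psi_def R_def by (rule proj_L_Phi_Phi[OF TL that])
      then show ?thesis by (simp add: R_def Phi_zero)
    qed
    show "x = 0" if R0: "\<And>i. R i x = 0"
    proof -
      have "T i x = 0" for i using TT[of i x x] R0[of i] by (metis cinner_zero_left nsq_eq_0_iff zero_complex.simps(1))
      then have "Psi (\<Phi> q x) = 0" by (auto simp: T_def fun_eq_iff)
      then have "\<Phi> q x q = 0" using Psi_eq_0D[OF Phi_coherent] by (metis zero_fun_apply)
      then show ?thesis by (simp add: Phi_self)
    qed
  qed
  \<comment> \<open>Coherence links \<open>F (\<pi> i)\<close> and \<open>F q\<close> at the common
    multiple \<open>\<pi> i * a = q * b\<close>.\<close>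
  moreover have "cinner (Psi (\<Phi> q h) i) (Psi F i) = cinner (R i h) (F q)" for i
  proof (cases rule: Phi_cases[of "\<pi> i" q])
    case (1 a b)
    have "cinner (Psi (\<Phi> q h) i) (Psi F i) = cinner (V a (A a (T i h))) (F (\<pi> i))"
      using 1 by (simp add: cinner_Psi Psi_in_L VA) (simp add: T_def)
    also have "\<dots> = cinner (T i h) (V a (F (\<pi> i * a)))"
      using 1 by (simp add: VA_selfadjoint coherentD[OF F])
    also have "\<dots> = cinner (T i h) (V a (A b (F q)))"
      unfolding lcm_complementD[OF 1(1)] using 1 by (simp add: coherentD[OF F])
    also have "\<dots> = cinner (R i h) (F q)" using 1 by (simp add: R_inner Phi_eq)
    finally show ?thesis .
  next
    case 2
    then have "T i h = 0" by (simp add: T_def Psi_def Phi_eq_0 proj_zero closed_subspace_L)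
    then show ?thesis by (simp add: TT) (simp add: T_def)
  qed
  ultimately show ?thesis by simp
qed

section \<open>The space of square-summable coherent functions\<close>

definition X :: "('p \<Rightarrow> 'h) set" where
  "X = {F. coherent F \<and> Psi F \<in> l2}"

lemma X_coherent: "F \<in> X \<Longrightarrow> coherent F" and X_l2: "F \<in> X \<Longrightarrow> Psi F \<in> l2"
  by (auto simp: X_def)

lemma X_zero: "0 \<in> X"
  by (auto simp: X_def coherent_def A_zero Psi_zero l2_def)

lemma X_add: "F \<in> X \<Longrightarrow> G \<in> X \<Longrightarrow> F + G \<in> X"
  by (auto simp: X_def Psi_add l2_add coherent_def A_add)

lemma X_sc: "F \<in> X \<Longrightarrow> l2sc t F \<in> X"
  by (auto simp: X_def Psi_sc l2_sc coherent_def A_sc) (simp_all add: l2sc_def A_sc)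

lemma X_diff: "F \<in> X \<Longrightarrow> G \<in> X \<Longrightarrow> F - G \<in> X"
  by (auto simp: X_def Psi_diff l2_diff coherent_def A_diff)

lemma X_sum: "(\<And>i. i \<in> S \<Longrightarrow> G i \<in> X) \<Longrightarrow> sum G S \<in> X"
  by (induction S rule: infinite_finite_induct) (auto simp: X_zero X_add)

lemma Phi_X: "\<Phi> q h \<in> X"
proof -
  have "(\<lambda>i. nsq (Psi (\<Phi> q h) i)) summable_on UNIV"
    by (rule summable_on_Re[OF has_sum_imp_summable[OF reproducing_has_sum[OF Phi_coherent]]])
  then show ?thesis unfolding X_def l2_def by (simp add: Phi_coherent)
qed

lemma reproducing: "F \<in> X \<Longrightarrow> l2inner (Psi (\<Phi> q h)) (Psi F) = cinner h (F q)"
  unfolding l2inner_def by (intro infsumI reproducing_has_sum X_coherent)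

lemma l2inner_Psi_sum:
  assumes "\<And>i. i \<in> S \<Longrightarrow> G i \<in> X" "F \<in> X"
  shows "l2inner (Psi (sum G S)) (Psi F) = (\<Sum>i\<in>S. l2inner (Psi (G i)) (Psi F))"
  using assms(1)
proof (induction S rule: infinite_finite_induct)
  case (insert i S)
  then have l2: "Psi (G i) \<in> l2" "Psi (sum G S) \<in> l2" by (auto intro: X_l2 X_sum)
  show ?case
    unfolding sum.insert[OF insert(1,2)] Psi_add l2inner_add_left[OF l2 X_l2[OF assms(2)]]
    using insert by simp
qed (simp_all add: Psi_zero l2inner_def)

text \<open>Pairing \<open>F\<close> with \<open>\<Phi> q (F q)\<close> gives
  \<open>nsq (F q)\<close>, which is also the squared norm of that vector.\<close>

lemma nsq_le_l2sq: "F \<in> X \<Longrightarrow> nsq (F q) \<le> l2sq (Psi F)"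
  using l2inner_le[OF X_l2[OF Phi_X[of q "F q"]] X_l2, of F]
  by (simp add: reproducing Phi_X Phi_self)

lemma sum_apply: "(sum G S) x = (\<Sum>i\<in>S. G i x)"
  by (induction S rule: infinite_finite_induct) auto

text \<open>By \<open>w_shift\<close> the Gram matrix does not depend on \<open>p\<close>, and for
  \<open>p = 1\<close> the summands lie in distinct orthogonal pieces.\<close>

lemma l2sq_sum_Phi:
  assumes "finite S" "\<And>i. f i \<in> L i"
  shows "l2sq (Psi (\<Sum>i\<in>S. \<Phi> (p * \<pi> i) (f i))) = (\<Sum>i\<in>S. nsq (f i))"
proof -
  have "l2inner (Psi (\<Sum>i\<in>S. \<Phi> (p * \<pi> i) (f i))) (Psi (\<Sum>i\<in>S. \<Phi> (p * \<pi> i) (f i)))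
      = (\<Sum>i\<in>S. \<Sum>j\<in>S. cinner (f i) (\<Phi> (p * \<pi> j) (f j) (p * \<pi> i)))"
    by (simp add: l2inner_Psi_sum Phi_X X_sum reproducing sum_apply cinner_sum_right)
  also have "\<dots> = (\<Sum>i\<in>S. \<Sum>j\<in>S. cinner (f i) (Psi (\<Phi> (\<pi> j) (f j)) i))"
    by (simp add: w_shift phi_coherent cinner_Psi assms(2))
  also have "\<dots> = (\<Sum>i\<in>S. cinner (f i) (f i))"
    using assms by (intro sum.cong refl) (simp add: Psi_Phi_delta if_distrib cong: if_cong)
  finally show ?thesis by simp
qed

text \<open>Duality: \<open>F\<close> is tested against finite sums \<open>G\<close> built from the
  coordinates of its shift, for which the pairing with \<open>F\<close> equals the squared norm of
  \<open>G\<close>. This sidesteps the missing compatibility of the well-order with multiplication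
  by \<open>p\<close>.\<close>

lemma shift_X:
  assumes F: "F \<in> X"
  shows "(\<lambda>t. F (p * t)) \<in> X" and "l2sq (Psi (\<lambda>t. F (p * t))) \<le> l2sq (Psi F)"
proof -
  define f where "f = Psi (\<lambda>t. F (p * t))"
  have bound: "(\<Sum>i\<in>S. nsq (f i)) \<le> l2sq (Psi F)" if S: "finite S" for S
  proof -
    define G where "G = (\<Sum>i\<in>S. \<Phi> (p * \<pi> i) (f i))"
    have fL: "f i \<in> L i" for i by (simp add: f_def Psi_in_L)
    have "l2inner (Psi G) (Psi F) = (\<Sum>i\<in>S. cinner (f i) (F (p * \<pi> i)))"
      by (simp add: G_def l2inner_Psi_sum Phi_X F reproducing)
    also have "\<dots> = (\<Sum>i\<in>S. cinner (f i) (f i))"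
      using cinner_Psi[OF fL, of _ "\<lambda>t. F (p * t)"] by (simp add: f_def)
    finally have "Re (l2inner (Psi G) (Psi F)) = (\<Sum>i\<in>S. nsq (f i))" by simp
    moreover have "l2sq (Psi G) = (\<Sum>i\<in>S. nsq (f i))"
      unfolding G_def by (rule l2sq_sum_Phi[OF S fL])
    moreover have "2 * Re (l2inner (Psi G) (Psi F)) \<le> l2sq (Psi G) + l2sq (Psi F)"
      unfolding G_def by (intro l2inner_le X_l2 X_sum Phi_X F)
    ultimately show ?thesis by linarith
  qed
  have "coherent (\<lambda>t. F (p * t))"
    using X_coherent[OF F] by (auto simp: coherent_def simp flip: mult.assoc)
  then show "(\<lambda>t. F (p * t)) \<in> X" using l2I[OF bound] by (simp add: X_def f_def)
  show "l2sq (Psi (\<lambda>t. F (p * t))) \<le> l2sq (Psi F)" using l2sq_le[OF bound] by (simp add: f_def)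
qed

text \<open>By \<open>Phi_shift\<close>, \<open>w p\<close> is the formal adjoint of the shift on
  the vectors \<open>W\<^sub>s h\<close>. The membership \<open>w p F \<in> X\<close> is derived
  from this relation afterwards.\<close>

lemma reproducing_shift:
  assumes F: "F \<in> X"
  shows "l2inner (Psi (\<lambda>t. \<Phi> s h (p * t))) (Psi F) = cinner h (w p F s)"
proof (cases rule: w_cases[of s p])
  case (1 a b)
  have "l2inner (Psi (\<lambda>t. \<Phi> s h (p * t))) (Psi F) = cinner (A a h) (F b)"
    by (simp add: Phi_shift[OF 1] reproducing F)
  then show ?thesis using 1 by (simp add: A_adjoint' w_eq X_coherent F)
next
  case 2
  then have "(\<lambda>t. \<Phi> s h (p * t)) = 0" by (auto simp: Phi_shift_0)
  then show ?thesis using 2 by (simp add: w_eq_0 Psi_zero l2inner_def)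
qed

text \<open>The duality argument of \<open>shift_X\<close> again, now with the shifted sum
  \<open>G'\<close> as test vector; contractivity of the shift bounds its norm.\<close>

lemma w_X:
  assumes F: "F \<in> X"
  shows "w p F \<in> X" and "l2sq (Psi (w p F)) \<le> l2sq (Psi F)"
proof -
  define f where "f = Psi (w p F)"
  have bound: "(\<Sum>i\<in>S. nsq (f i)) \<le> l2sq (Psi F)" if S: "finite S" for S
  proof -
    define G where "G = (\<Sum>i\<in>S. \<Phi> (\<pi> i) (f i))"
    define G' where "G' = (\<lambda>t. G (p * t))"
    have G: "G \<in> X" unfolding G_def by (intro X_sum Phi_X)
    have fL: "f i \<in> L i" for i by (simp add: f_def Psi_in_L)
    have "G' = (\<Sum>i\<in>S. (\<lambda>t. \<Phi> (\<pi> i) (f i) (p * t)))"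
      by (auto simp: G'_def G_def sum_apply)
    then have "l2inner (Psi G') (Psi F) = (\<Sum>i\<in>S. cinner (f i) (w p F (\<pi> i)))"
      by (simp add: l2inner_Psi_sum shift_X Phi_X F reproducing_shift)
    also have "\<dots> = (\<Sum>i\<in>S. cinner (f i) (f i))"
      using cinner_Psi[OF fL, of _ "w p F"] by (simp add: f_def)
    finally have "Re (l2inner (Psi G') (Psi F)) = (\<Sum>i\<in>S. nsq (f i))" by simp
    moreover have "l2sq (Psi G') \<le> (\<Sum>i\<in>S. nsq (f i))"
      using shift_X(2)[OF G, of p] l2sq_sum_Phi[OF S fL, of 1] by (simp add: G'_def G_def)
    moreover have "2 * Re (l2inner (Psi G') (Psi F)) \<le> l2sq (Psi G') + l2sq (Psi F)"
      unfolding G'_def by (intro l2inner_le X_l2 shift_X G F)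
    ultimately show ?thesis by linarith
  qed
  show "w p F \<in> X" using l2I[OF bound] w_coherent[OF X_coherent[OF F]] by (simp add: X_def f_def)
  show "l2sq (Psi (w p F)) \<le> l2sq (Psi F)" using l2sq_le[OF bound] by (simp add: f_def)
qed

section \<open>The dilated representation\<close>

lemma inj_on_Psi: "inj_on Psi X"
proof (rule inj_onI)
  fix F G assume FG: "F \<in> X" "G \<in> X" "Psi F = Psi G"
  then have "F - G = 0" by (intro Psi_eq_0D X_coherent X_diff) (simp_all add: Psi_diff)
  then show "F = G" by simp
qed

text \<open>Point evaluations are contractive, so a Cauchy sequence converges pointwise, and
  continuity of \<open>A a\<close> makes the limit coherent. Norm convergence comes from estimates
  over finite index sets.\<close>

lemma X_complete:
  assumes F: "\<And>n. F n \<in> X"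
    and cauchy: "\<forall>e>0. \<exists>N. \<forall>m\<ge>N. \<forall>n\<ge>N. l2sq (Psi (F m) - Psi (F n)) < e"
  shows "\<exists>G\<in>X. (\<lambda>n. l2sq (Psi (F n) - Psi G)) \<longlonglongrightarrow> 0"
proof -
  have "\<exists>y. (\<lambda>n. nsq (F n q - y)) \<longlonglongrightarrow> 0" for q
  proof (rule cinner_complete, intro allI impI)
    fix e :: real assume "e > 0"
    with cauchy obtain N where N: "\<And>m n. m \<ge> N \<Longrightarrow> n \<ge> N \<Longrightarrow> l2sq (Psi (F m) - Psi (F n)) < e"
      by blast
    have "nsq (F m q - F n q) \<le> l2sq (Psi (F m) - Psi (F n))" for m n
      using nsq_le_l2sq[OF X_diff[OF F F], of m n q] by (simp add: Psi_diff)
    then show "\<exists>N. \<forall>m\<ge>N. \<forall>n\<ge>N. nsq (F m q - F n q) < e" using N by (meson le_less_trans)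
  qed
  then obtain G where G: "\<And>q. (\<lambda>n. nsq (F n q - G q)) \<longlonglongrightarrow> 0" by metis
  have coh: "coherent G"
    unfolding coherent_def
  proof (intro allI ballI)
    fix s a assume a: "a \<in> P1"
    have "(\<lambda>n. nsq (A a (F n s) - A a (G s))) \<longlonglongrightarrow> 0"
      by (rule tendsto_sandwich[OF _ _ tendsto_const G[of s]])
         (auto simp: nsq_A_le a simp flip: A_diff)
    then have "(\<lambda>n. nsq (F n (s * a) - A a (G s))) \<longlonglongrightarrow> 0"
      by (simp add: coherentD[OF X_coherent[OF F] a])
    then show "G (s * a) = A a (G s)" by (rule nsq_limit_unique[OF G])
  qed
  have tail: "\<exists>N. \<forall>m\<ge>N. \<forall>S. finite S \<longrightarrow> (\<Sum>i\<in>S. nsq (Psi (F m - G) i)) \<le> e" if e: "e > 0" for e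
  proof -
    obtain N where N: "\<And>m n. m \<ge> N \<Longrightarrow> n \<ge> N \<Longrightarrow> l2sq (Psi (F m) - Psi (F n)) < e / 4"
      using cauchy e by (meson divide_pos_pos zero_less_numeral)
    have "(\<Sum>i\<in>S. nsq (Psi (F m - G) i)) \<le> e" if "m \<ge> N" "finite S" for m S
    proof -
      have "(\<lambda>n. \<Sum>i\<in>S. nsq (F n (\<pi> i) - G (\<pi> i))) \<longlonglongrightarrow> (\<Sum>i\<in>S. 0)"
        by (intro tendsto_sum G)
      then have "\<forall>\<^sub>F n in sequentially. (\<Sum>i\<in>S. nsq (F n (\<pi> i) - G (\<pi> i))) < e / 4"
        using e by (auto dest!: order_tendstoD(2)[where a = "e / 4"])
      \<comment> \<open>The index \<open>n\<close> may depend on \<open>S\<close>, whereas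
        \<open>N\<close> does not.\<close>
      then obtain n where n: "n \<ge> N" "(\<Sum>i\<in>S. nsq (F n (\<pi> i) - G (\<pi> i))) < e / 4"
        unfolding eventually_sequentially by (meson nle_le)
      have "nsq (Psi (F m - G) i) \<le> 2 * nsq ((Psi (F m) - Psi (F n)) i) + 2 * nsq (F n (\<pi> i) - G (\<pi> i))" for i
      proof -
        have "nsq (Psi (F m - G) i) \<le> 2 * nsq (Psi (F m) i - Psi (F n) i) + 2 * nsq (Psi (F n) i - Psi G i)"
          unfolding Psi_diff minus_apply by (rule nsq_diff_le)
        moreover have "nsq (Psi (F n) i - Psi G i) \<le> nsq (F n (\<pi> i) - G (\<pi> i))"
          unfolding Psi_def using nsq_proj_le[OF closed_subspace_L]
          by (simp add: closed_subspace_L flip: proj_diff)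
        ultimately show ?thesis by simp
      qed
      then have "(\<Sum>i\<in>S. nsq (Psi (F m - G) i))
        \<le> (\<Sum>i\<in>S. 2 * nsq ((Psi (F m) - Psi (F n)) i) + 2 * nsq (F n (\<pi> i) - G (\<pi> i)))"
        by (intro sum_mono)
      also have "\<dots> = 2 * (\<Sum>i\<in>S. nsq ((Psi (F m) - Psi (F n)) i)) + 2 * (\<Sum>i\<in>S. nsq (F n (\<pi> i) - G (\<pi> i)))"
        by (simp only: sum.distrib sum_distrib_left)
      also have "\<dots> \<le> e"
        using sum_le_l2sq[OF l2_diff[OF X_l2[OF F] X_l2[OF F]] that(2), of m n] N[OF that(1) n(1)] n(2)
        by linarith
      finally show ?thesis .
    qed
    then show ?thesis by blast
  qed
  obtain m where "\<And>S. finite S \<Longrightarrow> (\<Sum>i\<in>S. nsq (Psi (F m - G) i)) \<le> 1"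
    using tail[of 1] by auto
  then have "Psi (F m - G) \<in> l2" by (rule l2I)
  then have "F m - G \<in> X"
    using coh X_coherent[OF F, of m] by (auto simp: X_def coherent_def A_diff)
  then have "F m - (F m - G) \<in> X" by (rule X_diff[OF F])
  then have GX: "G \<in> X" by simp
  have "(\<lambda>n. l2sq (Psi (F n) - Psi G)) \<longlonglongrightarrow> 0"
    unfolding tendsto_iff eventually_sequentially
  proof (intro allI impI)
    fix e :: real assume e: "e > 0"
    obtain N where N: "\<And>m S. m \<ge> N \<Longrightarrow> finite S \<Longrightarrow> (\<Sum>i\<in>S. nsq (Psi (F m - G) i)) \<le> e / 2"
      using tail[of "e / 2"] e by auto
    have "dist (l2sq (Psi (F n) - Psi G)) 0 < e" if "n \<ge> N" for n
    proof -
      have "l2sq (Psi (F n - G)) \<le> e / 2" by (rule l2sq_le[OF N[OF that]])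
      then have "l2sq (Psi (F n) - Psi G) < e" unfolding Psi_diff using e by linarith
      then show ?thesis using l2sq_nonneg[of "Psi (F n) - Psi G"] unfolding dist_real_def by linarith
    qed
    then show "\<exists>N. \<forall>n\<ge>N. dist (l2sq (Psi (F n) - Psi G)) 0 < e" by blast
  qed
  with GX show ?thesis by blast
qed

abbreviation K :: "('i \<Rightarrow> 'h) set" where
  "K \<equiv> Psi ` X"

lemma K_subspace: "l2_hilbert_subspace K"
  unfolding l2_hilbert_subspace_def
proof (intro conjI ballI allI impI)
  show "K \<subseteq> l2" using X_l2 by blast
  show "0 \<in> K" using X_zero Psi_zero by (metis imageI)
  show "f + g \<in> K" if "f \<in> K" "g \<in> K" for f g using that X_add by (auto simp flip: Psi_add)
  show "l2sc a f \<in> K" if "f \<in> K" for f a using that X_sc by (auto simp flip: Psi_sc)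
  fix Y :: "nat \<Rightarrow> 'i \<Rightarrow> 'h"
  assume "\<forall>n. Y n \<in> K" and cauchy: "\<forall>e>0. \<exists>N. \<forall>m\<ge>N. \<forall>n\<ge>N. l2sq (Y m - Y n) < e"
  then obtain F where F: "\<And>n. F n \<in> X" "\<And>n. Y n = Psi (F n)" unfolding image_iff by metis
  show "\<exists>L\<in>K. (\<lambda>n. l2sq (Y n - L)) \<longlonglongrightarrow> 0"
    using X_complete[OF F(1) cauchy[unfolded F(2)]] unfolding F(2) by (rule bexE) (rule bexI, assumption, rule imageI)
qed

lemma K_l2: "K \<subseteq> l2" and K_add: "f \<in> K \<Longrightarrow> g \<in> K \<Longrightarrow> f + g \<in> K" and K_sc: "f \<in> K \<Longrightarrow> l2sc t f \<in> K"
  using K_subspace by (auto simp: l2_hilbert_subspace_def)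

lemma K_diff: "f \<in> K \<Longrightarrow> g \<in> K \<Longrightarrow> f - g \<in> K"
  using X_diff by (auto simp flip: Psi_diff)

section \<open>The operators \<open>W p\<close> on \<open>K\<close> and their adjoints\<close>

definition on_K :: "(('p \<Rightarrow> 'h) \<Rightarrow> ('p \<Rightarrow> 'h)) \<Rightarrow> ('i \<Rightarrow> 'h) \<Rightarrow> ('i \<Rightarrow> 'h)" where
  "on_K T k = Psi (T (the_inv_into X Psi k))"

lemma on_K_Psi: "F \<in> X \<Longrightarrow> on_K T (Psi F) = Psi (T F)"
  by (simp add: on_K_def the_inv_into_f_f[OF inj_on_Psi])

definition W :: "'p \<Rightarrow> ('i \<Rightarrow> 'h) \<Rightarrow> ('i \<Rightarrow> 'h)" where
  "W p = on_K (w p)"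

definition W_adj :: "'p \<Rightarrow> ('i \<Rightarrow> 'h) \<Rightarrow> ('i \<Rightarrow> 'h)" where
  "W_adj p = on_K (\<lambda>F t. F (p * t))"

lemma W_Psi: "F \<in> X \<Longrightarrow> W p (Psi F) = Psi (w p F)"
  by (simp add: W_def on_K_Psi)

lemma W_adj_Psi: "F \<in> X \<Longrightarrow> W_adj p (Psi F) = Psi (\<lambda>t. F (p * t))"
  by (simp add: W_adj_def on_K_Psi)

lemma W_lin: "lin_on K l2sc (W p)"
  unfolding lin_on_def
  by (auto simp: W_Psi w_X X_add X_sc w_add w_sc simp flip: Psi_add Psi_sc)

lemma W_adj_lin: "lin_on K l2sc (W_adj p)"
  unfolding lin_on_def
proof (intro conjI ballI allI)
  show "W_adj p f \<in> K" if "f \<in> K" for f using that by (auto simp: W_adj_Psi shift_X)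
  show "W_adj p (f + g) = W_adj p f + W_adj p g" if fg: "f \<in> K" "g \<in> K" for f g
  proof -
    obtain F G where FG: "F \<in> X" "G \<in> X" "f = Psi F" "g = Psi G" using fg by blast
    have "W_adj p (f + g) = Psi (\<lambda>t. (F + G) (p * t))"
      unfolding FG Psi_add[symmetric] by (rule W_adj_Psi) (simp add: FG X_add)
    also have "\<dots> = Psi ((\<lambda>t. F (p * t)) + (\<lambda>t. G (p * t)))" by (simp add: plus_fun_def)
    finally show ?thesis using FG by (simp add: Psi_add W_adj_Psi)
  qed
  show "W_adj p (l2sc t f) = l2sc t (W_adj p f)" if f: "f \<in> K" for t f
  proof -
    obtain F where F: "F \<in> X" "f = Psi F" using f by blast
    have "W_adj p (l2sc t f) = Psi (\<lambda>s. (l2sc t F) (p * s))"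
      unfolding F Psi_sc[symmetric] by (rule W_adj_Psi) (simp add: F X_sc)
    also have "\<dots> = Psi (l2sc t (\<lambda>s. F (p * s)))" by (simp add: l2sc_def)
    finally show ?thesis using F by (simp add: Psi_sc W_adj_Psi)
  qed
qed

lemma W_isometry: "isometry_on K l2sc l2inner (W p)"
  and W_adjoint: "adjoint_on K l2inner (W p) (W_adj p)"
proof -
  have *: "l2sq (W p f) \<le> l2sq f" "l2sq (W_adj p f) \<le> l2sq f" "W_adj p (W p f) = f" if "f \<in> K" for f
    using that by (auto simp: W_Psi W_adj_Psi w_X shift_X w_of_multiple X_coherent)
  note contraction_left_inverse_adjoint[OF K_l2 K_add K_sc W_lin *(1) W_adj_lin *(2,3)]
  then show "isometry_on K l2sc l2inner (W p)" "adjoint_on K l2inner (W p) (W_adj p)" by simp_all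
qed

lemma adj_W: "F \<in> X \<Longrightarrow> adj K l2inner (W p) (Psi F) = Psi (\<lambda>t. F (p * t))"
proof -
  assume F: "F \<in> X"
  have "W p k \<in> K" if "k \<in> K" for k using that by (rule lin_onD(1)[OF W_lin])
  then have "adj K l2inner (W p) (Psi F) = W_adj p (Psi F)"
    using F by (intro adj_eqI[OF K_l2 K_diff W_adjoint]) auto
  with F show ?thesis by (simp add: W_adj_Psi)
qed

text \<open>Passing to adjoints reduces multiplicativity to the composition of shifts, where it is
  associativity in \<open>P\<close>.\<close>

lemma w_mult:
  assumes F: "F \<in> X" shows "w (p * q) F = w p (w q F)"
proof -
  have *: "l2inner (W (p * q) (Psi F)) k = l2inner (W p (W q (Psi F))) k" if k: "k \<in> K" for k
  proof -
    obtain G where G: "G \<in> X" "k = Psi G" using k by blast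
    have adj: "l2inner (W r f) k = l2inner f (W_adj r k)" if "f \<in> K" "k \<in> K" for r f k
      using W_adjoint[of r] that unfolding adjoint_on_def by blast
    have K: "Psi F \<in> K" "W q (Psi F) \<in> K" "W_adj p k \<in> K"
      using F G by (auto simp: W_Psi w_X W_adj_Psi shift_X)
    have "W_adj (p * q) k = W_adj q (W_adj p k)"
      using G by (simp add: W_adj_Psi shift_X mult.assoc)
    then show ?thesis unfolding adj[OF K(1) k] adj[OF K(2) k] adj[OF K(1,3)] by simp
  qed
  define d where "d = Psi (w (p * q) F) - Psi (w p (w q F))"
  have in_K: "Psi (w (p * q) F) \<in> K" "Psi (w p (w q F)) \<in> K" using F by (auto simp: w_X)
  have d: "d \<in> K" unfolding d_def using in_K by (rule K_diff)
  have "l2inner d d = 0"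
    using *[OF d] in_K d K_l2 F
    by (subst (1) d_def) (simp add: l2inner_diff_left subset_iff W_Psi w_X)
  then have "d = 0" using l2sq_zero_iff d K_l2 by (metis subset_iff zero_complex.simps(1))
  then show ?thesis using inj_onD[OF inj_on_Psi] F by (simp add: d_def w_X)
qed

text \<open>The range projection \<open>W\<^sub>p W\<^sub>p\<^sup>*\<close> on the level of
  functions.\<close>

definition E :: "'p \<Rightarrow> ('p \<Rightarrow> 'h) \<Rightarrow> 'p \<Rightarrow> 'h" where
  "E p F = w p (\<lambda>t. F (p * t))"

lemma E_eq: "coherent F \<Longrightarrow> lcm_complement s p a b \<Longrightarrow> a \<in> P1 \<Longrightarrow> E p F s = V a (A a (F s))"
  by (simp add: E_def w_shift_pointwise)

lemma E_eq_0: "(\<And>a b. a \<in> P1 \<Longrightarrow> s * a \<noteq> p * b) \<Longrightarrow> E p F s = 0"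
  by (simp add: E_def w_eq_0)

lemma E_coherent: "coherent F \<Longrightarrow> coherent (E p F)"
  unfolding E_def by (rule w_coherent) (auto simp: coherent_def simp flip: mult.assoc)

text \<open>At \<open>s\<close> a product of two range projections of \<open>V\<close> appears. Were
  they not orthogonal, \<open>a\<close> and \<open>c\<close> would have a common multiple in
  \<open>P1\<close>, and multiplying it by \<open>s\<close> on the left would give an element of
  both ideals.\<close>

lemma E_E_eq_0:
  assumes F: "coherent F" and s: "\<And>c. c \<in> P1 \<Longrightarrow> s * c \<notin> rideal UNIV x \<inter> rideal UNIV y"
  shows "E x (E y F) s = 0"
proof (cases rule: w_cases[of s x])
  case ab: (1 a b)
  show ?thesis
  proof (cases rule: w_cases[of s y])
    case cd: (1 c d)
    have "A a (V c (A c (F s))) = 0"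
    proof (rule A_V_orth[OF ab(2) cd(2)])
      fix u v
      show "a * u \<noteq> c * v"
      proof
        assume "a * u = c * v"
        then obtain u v where uv: "lcm_complement a c u v" by (metis lcm_complement_exists)
        have "s * (a * u) = x * (b * u)" using lcm_complementD[OF ab(1)] by (metis mult.assoc)
        moreover have "s * (a * u) = y * (d * v)"
          using lcm_complementD[OF cd(1)] lcm_complementD[OF uv] by (metis mult.assoc)
        ultimately have "s * (a * u) \<in> rideal UNIV x \<inter> rideal UNIV y"
          unfolding Int_iff rideal_iff by blast
        then show False using s mult_P1[OF ab(2)] lcm_complement_inside_P1[OF uv ab(2) cd(2)] by blast
      qed
    qed
    then show ?thesis using ab cd by (simp add: E_eq F E_coherent V_zero)
  next
    case 2
    then show ?thesis using ab by (simp add: E_eq F E_coherent E_eq_0[of s y] A_zero V_zero)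
  qed
qed (rule E_eq_0)

lemma E_nica_disjoint:
  assumes "coherent F" "join_in UNIV x y = {}" shows "E x (E y F) = 0"
proof
  have "z \<notin> rideal UNIV x \<inter> rideal UNIV y" for z
  proof
    assume "z \<in> rideal UNIV x \<inter> rideal UNIV y"
    then obtain c d where "x * c = y * d" by (metis IntE rideal_iff)
    then show False using assms(2) lcm_complement_exists lcm_complement_join by (metis empty_iff)
  qed
  then show "E x (E y F) s = 0 s" for s using E_E_eq_0[OF assms(1)] by simp
qed

text \<open>The cofactor of \<open>s\<close> with respect to \<open>r\<close> is a least common
  multiple of its cofactors with respect to \<open>x\<close> and \<open>y\<close>, so the identity
  at \<open>s\<close> is the covariance of \<open>V\<close> for these two cofactors.\<close>

lemma E_nica_join:
  assumes F: "coherent F" and r: "r \<in> join_in UNIV x y" shows "E x (E y F) = E r F"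
proof
  fix s
  have I: "rideal UNIV x \<inter> rideal UNIV y = rideal UNIV r" using r by (simp add: join_in_def)
  show "E x (E y F) s = E r F s"
  proof (cases "\<exists>m\<in>P1. \<exists>n. s * m = r * n")
    case True
    then obtain m n where m: "m \<in> P1" "s * m = r * n" by blast
    have "s * m \<in> rideal UNIV x \<inter> rideal UNIV y" unfolding I rideal_iff using m by blast
    then obtain x' y' where xy: "s * m = x * x'" "s * m = y * y'" by (metis IntE rideal_iff)
    obtain a b where ab: "lcm_complement s x a b" using lcm_complement_exists[OF xy(1)] .
    obtain c d where cd: "lcm_complement s y c d" using lcm_complement_exists[OF xy(2)] .
    have P: "a \<in> P1" "c \<in> P1" using lcm_complement_P1[OF ab xy(1) m(1)] lcm_complement_P1[OF cd xy(2) m(1)] .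
    obtain e where e: "m = a * e" using lcm_complementE[OF ab xy(1)] .
    obtain f where f: "m = c * f" using lcm_complementE[OF cd xy(2)] .
    obtain u v where uv: "lcm_complement a c u v" using lcm_complement_exists[of a e c f] e f by metis
    note uv' = lcm_complement_inside_P1[OF uv P]
    have 1: "s * (a * u) = x * (b * u)" using lcm_complementD[OF ab] by (metis mult.assoc)
    have 2: "s * (a * u) = y * (d * v)" using lcm_complementD[OF cd] lcm_complementD[OF uv] by (metis mult.assoc)
    have "s * (a * u) \<in> rideal UNIV r"
      unfolding I[symmetric] Int_iff rideal_iff using 1 2 by blast
    then obtain n' where n': "s * (a * u) = r * n'" unfolding rideal_iff by blast
    have "lcm_complement s r (a * u) n'"
      unfolding lcm_complement_def
    proof (intro conjI allI impI n')
      fix g h assume gh: "s * g = r * h"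
      have "s * g \<in> rideal UNIV x \<inter> rideal UNIV y" unfolding I rideal_iff using gh by blast
      then obtain x'' y'' where xy': "s * g = x * x''" "s * g = y * y''" by (metis IntE rideal_iff)
      obtain e' where e': "g = a * e'" using lcm_complementE[OF ab xy'(1)] .
      obtain f' where f': "g = c * f'" using lcm_complementE[OF cd xy'(2)] .
      obtain k where k: "e' = u * k" using lcm_complementE[OF uv, of e' f'] e' f' by metis
      have "h = n' * k" by (rule cancel[of r]) (metis gh e' k n' mult.assoc)
      then show "\<exists>e. g = a * u * e \<and> h = n' * e" using e' k by (auto simp: mult.assoc)
    qed
    moreover have "a * u \<in> P1" using P uv' by (simp add: mult_P1)
    ultimately have "E r F s = V (a * u) (A (a * u) (F s))" by (rule E_eq[OF F])
    also have "\<dots> = V a (V u (A v (A c (F s))))"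
      unfolding V_mult[OF P(1) uv'(1)] using A_mult[OF P(2) uv'(2)] lcm_complementD[OF uv] by simp
    also have "\<dots> = V a (A a (V c (A c (F s))))" by (simp add: A_V_lcm_complement[OF uv P])
    also have "\<dots> = E x (E y F) s" by (simp add: E_eq[OF _ ab] E_eq[OF _ cd] P F E_coherent)
    finally show ?thesis by simp
  next
    case False
    then have "E x (E y F) s = 0" by (intro E_E_eq_0[OF F]) (auto simp: I rideal_iff)
    moreover have "E r F s = 0" using False by (intro E_eq_0) blast
    ultimately show ?thesis by simp
  qed
qed

lemma W_nica_rep: "nica_rep K l2sc l2inner UNIV W"
proof -
  have WW: "W x (adj K l2inner (W x) (Psi F)) = Psi (E x F)" and EX: "E x F \<in> X" if "F \<in> X" for x F
    using that by (simp_all add: adj_W W_Psi shift_X E_def w_X)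
  show ?thesis
    unfolding nica_rep_def
    by (auto simp: W_Psi w_one X_coherent w_mult w_X W_isometry WW EX E_nica_disjoint E_nica_join Psi_zero)
qed

section \<open>The embedding of \<open>H\<close> and the compressions to it\<close>

definition \<iota> :: "'h \<Rightarrow> 'i \<Rightarrow> 'h" where
  "\<iota> h = Psi (\<phi> h)"

lemma phi_X: "\<phi> h \<in> X"
  using Phi_X[of 1 h] by (simp add: w_one phi_coherent)

lemma iota_inner: "F \<in> X \<Longrightarrow> l2inner (\<iota> h) (Psi F) = cinner h (F 1)"
  using reproducing[of F 1 h] by (simp add: w_one phi_coherent \<iota>_def)

text \<open>Evaluation at 1 is the component in \<open>H\<close>, and the cofactors of 1 and
  \<open>p\<close> are \<open>p\<close> and 1. This yields both the compression of
  \<open>W p\<close> and the invariance of the orthogonal complement.\<close>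

lemma w_at_one:
  assumes "coherent F"
  shows "p \<in> P1 \<Longrightarrow> w p F 1 = V p (F 1)" and "p \<notin> P1 \<Longrightarrow> w p F 1 = 0"
proof -
  have "lcm_complement 1 p p 1" using lcm_complement_commute[OF lcm_complement_multiple[of 1 p]] lcm_complement_multiple[of 1 p]
    by (simp add: lcm_complement_def)
  then show "p \<in> P1 \<Longrightarrow> w p F 1 = V p (F 1)" by (rule w_eq[OF assms])
  show "p \<notin> P1 \<Longrightarrow> w p F 1 = 0" by (rule w_eq_0) (auto dest: factor_left)
qed

lemma iota_K: "\<iota> h \<in> K"
  by (simp add: \<iota>_def phi_X)

lemma iota_add: "\<iota> (h + g) = \<iota> h + \<iota> g"
  by (simp add: \<iota>_def phi_add Psi_add)

lemma iota_sc: "\<iota> (scaleC t h) = l2sc t (\<iota> h)"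
  by (simp add: \<iota>_def phi_sc Psi_sc)

lemma iota_isometric: "l2inner (\<iota> h) (\<iota> g) = cinner h g"
  using iota_inner[OF phi_X, of h g] by (simp add: \<iota>_def phi_one)

text \<open>By \<open>iota_inner\<close>, pairing with the vectors \<open>\<iota> g\<close> sees
  exactly the value at 1.\<close>

lemma orth_proj_iota:
  assumes F: "F \<in> X" shows "orth_proj l2inner (range \<iota>) (Psi F) = \<iota> (F 1)"
  unfolding orth_proj_def
proof (rule the_equality)
  have key: "l2inner (\<iota> g) (Psi F - \<iota> h) = cinner g (F 1 - h)" for g h
    using iota_inner[OF X_diff[OF F phi_X], of g h] by (simp add: \<iota>_def Psi_diff phi_one)
  show "\<iota> (F 1) \<in> range \<iota> \<and> (\<forall>m'\<in>range \<iota>. l2inner m' (Psi F - \<iota> (F 1)) = 0)"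
    by (auto simp: key)
  fix m assume m: "m \<in> range \<iota> \<and> (\<forall>m'\<in>range \<iota>. l2inner m' (Psi F - m) = 0)"
  then obtain h where h: "m = \<iota> h" by blast
  then have "cinner g (F 1 - h) = 0" for g using m key by auto
  then have "F 1 - h = 0" by (intro cinner_eqI) simp
  then show "m = \<iota> (F 1)" by (simp add: h)
qed

lemma dilation:
  "l2_hilbert_subspace K \<and> (\<forall>h. \<iota> h \<in> K) \<and>
   (\<forall>h g. \<iota> (h + g) = \<iota> h + \<iota> g) \<and> (\<forall>a h. \<iota> (scaleC a h) = l2sc a (\<iota> h)) \<and>
   (\<forall>h g. l2inner (\<iota> h) (\<iota> g) = cinner h g) \<and>
   nica_rep K l2sc l2inner UNIV W \<and>
   (let Hperp = {k\<in>K. \<forall>h. l2inner (\<iota> h) k = 0} in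
     (\<forall>p. \<forall>k\<in>Hperp. W p k \<in> Hperp) \<and>
     (\<forall>p\<in>P1. \<forall>h. orth_proj l2inner (range \<iota>) (W p (\<iota> h)) = \<iota> (V p h)) \<and>
     (\<forall>p. p \<notin> P1 \<longrightarrow> (\<forall>h. orth_proj l2inner (range \<iota>) (W p (\<iota> h)) = 0)) \<and>
     (\<forall>p\<in>P1. \<exists>D. bounded_op_on Hperp l2sc l2inner D \<and>
        (\<forall>h. \<forall>k\<in>Hperp. W p (\<iota> h + k) = \<iota> (V p h) + D k)))"
proof -
  define Hperp where "Hperp = {k\<in>K. \<forall>h. l2inner (\<iota> h) k = 0}"
  have perp: "Psi F \<in> Hperp \<longleftrightarrow> F 1 = 0" if "F \<in> X" for F
    using that by (auto simp: Hperp_def iota_inner intro: cinner_eqI)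
  have W_perp: "W p k \<in> Hperp" if k: "k \<in> Hperp" for p k
  proof -
    obtain F where F: "F \<in> X" "k = Psi F" using k by (auto simp: Hperp_def)
    then have "F 1 = 0" using k perp by simp
    then have "w p F 1 = 0" using w_at_one[OF X_coherent[OF F(1)], of p] V_zero by (cases "p \<in> P1") auto
    then show ?thesis using F by (simp add: W_Psi perp w_X)
  qed
  have W_iota: "W p (\<iota> h) = Psi (\<Phi> p h)" for p h by (simp add: \<iota>_def W_Psi phi_X)
  have proj: "orth_proj l2inner (range \<iota>) (W p (\<iota> h)) = \<iota> (\<Phi> p h 1)" for p h
    unfolding W_iota by (rule orth_proj_iota[OF Phi_X])
  have Hperp_K: "Hperp \<subseteq> K" by (auto simp: Hperp_def)
  have bounded: "bounded_op_on Hperp l2sc l2inner (W p)" for p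
  proof -
    have "lin_on Hperp l2sc (W p)"
      unfolding lin_on_def
    proof (intro conjI ballI allI W_perp)
      fix f g t assume "f \<in> Hperp" "g \<in> Hperp"
      then have "f \<in> K" "g \<in> K" using Hperp_K by blast+
      then show "W p (f + g) = W p f + W p g" "W p (l2sc t f) = l2sc t (W p f)"
        by (simp_all only: lin_onD[OF W_lin])
    qed
    moreover have "l2sq (W p k) \<le> 1 * l2sq k" if "k \<in> Hperp" for k
      using W_isometry[of p] Hperp_K that by (auto simp: isometry_on_def)
    ultimately show ?thesis unfolding bounded_op_on_def by blast
  qed
  \<comment> \<open>On the complement \<open>W p\<close> itself serves as the lower right block
    \<open>D\<close>.\<close>
  have split: "W p (\<iota> h + k) = \<iota> (V p h) + W p k" if "p \<in> P1" "k \<in> Hperp" for p h k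
  proof -
    have "W p (\<iota> h + k) = W p (\<iota> h) + W p k"
      by (rule lin_onD(2)[OF W_lin iota_K subsetD[OF Hperp_K that(2)]])
    also have "W p (\<iota> h) = \<iota> (V p h)"
      by (simp only: W_iota w_phi[OF that(1)] \<iota>_def[symmetric])
    finally show ?thesis .
  qed
  have D: "\<forall>p\<in>P1. \<exists>D. bounded_op_on Hperp l2sc l2inner D \<and>
      (\<forall>h. \<forall>k\<in>Hperp. W p (\<iota> h + k) = \<iota> (V p h) + D k)"
    using bounded split by blast
  have iota_0: "\<iota> 0 = 0" using iota_add[of 0 0] by simp
  have "\<Phi> p h 1 = V p h" if "p \<in> P1" for p h
    using w_at_one(1)[OF phi_coherent that] by (simp add: phi_one)
  moreover have "\<Phi> p h 1 = 0" if "p \<notin> P1" for p h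
    using w_at_one(2)[OF phi_coherent that] .
  ultimately show ?thesis
    unfolding Let_def Hperp_def[symmetric]
    using K_subspace iota_K iota_add iota_sc iota_isometric W_nica_rep W_perp
    by (intro conjI D) (auto simp: proj iota_0)
qed

end

theorem mainTheorem4:
  fixes P1 :: "'p::monoid_mult set"
    and V :: "'p \<Rightarrow> 'h::complex_hilbert \<Rightarrow> 'h"
  assumes "right_LCM (UNIV :: 'p set)"
    and "submonoid P1"
    and "closed_under_factorization P1"
    and "preserves_orthogonality P1"
    and "nica_rep UNIV scaleC cinner P1 V"
  shows "\<exists>(K :: ('p list \<Rightarrow> 'h) set) (\<iota> :: 'h \<Rightarrow> ('p list \<Rightarrow> 'h)) (W :: 'p \<Rightarrow> ('p list \<Rightarrow> 'h) \<Rightarrow> ('p list \<Rightarrow> 'h)).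
     l2_hilbert_subspace K \<and>
     (\<forall>h. \<iota> h \<in> K) \<and>
     (\<forall>h g. \<iota> (h + g) = \<iota> h + \<iota> g) \<and> (\<forall>a h. \<iota> (scaleC a h) = l2sc a (\<iota> h)) \<and>
     (\<forall>h g. l2inner (\<iota> h) (\<iota> g) = cinner h g) \<and>
     nica_rep K l2sc l2inner UNIV W \<and>
     (let Hperp = {k\<in>K. \<forall>h. l2inner (\<iota> h) k = 0} in
       (\<forall>p. \<forall>k\<in>Hperp. W p k \<in> Hperp) \<and>
       (\<forall>p\<in>P1. \<forall>h. orth_proj l2inner (range \<iota>) (W p (\<iota> h)) = \<iota> (V p h)) \<and>
       (\<forall>p. p \<notin> P1 \<longrightarrow> (\<forall>h. orth_proj l2inner (range \<iota>) (W p (\<iota> h)) = 0)) \<and>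
       (\<forall>p\<in>P1. \<exists>D. bounded_op_on Hperp l2sc l2inner D \<and>
          (\<forall>h. \<forall>k\<in>Hperp. W p (\<iota> h + k) = \<iota> (V p h) + D k)))"
proof -
  obtain r :: "'p list rel" where r: "well_order_on UNIV r"
    using well_order_on by blast
  \<comment> \<open>Singletons show that \<open>hd\<close> is onto; the strict part of an arbitrary
    well-order of the lists orders the pieces.\<close>
  have "nica_dilation P1 V (hd :: 'p list \<Rightarrow> 'p) (r - Id)"
  proof
    show "surj (hd :: 'p list \<Rightarrow> 'p)" by (rule surjI[of _ "\<lambda>p. [p]"]) simp
    show "wf (r - Id)" using r by (simp add: well_order_on_def)
    show "(i, j) \<in> r - Id \<or> (j, i) \<in> r - Id" if "i \<noteq> j" for i j
      using r that by (auto simp: well_order_on_def linear_order_on_def total_on_def)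
  qed (fact assms)+
  then interpret D: nica_dilation P1 V "hd :: 'p list \<Rightarrow> 'p" "r - Id" .
  show ?thesis by (intro exI) (rule D.dilation)
qed

end
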